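(* Let $d\ge1$, $\mu>-\frac12$, $\beta>-d$, $\gamma>-1$ with $2\mu+\beta+d>0$. The polynomials $\mathsf{U}^{\mathsf J}_{\mathbf k,n}$ and $\mathsf{V}^{\mathsf J}_{\mathbf j,n}$ are partially biorthogonal in the sense that, for $\mathbf k,\mathbf j\in\mathbb{N}_0^d$ with $k=|\mathbf k|\le n$ and $j=|\mathbf j|\le n$, $$b^J_{\beta,\gamma,\mu}\int_{\mathbb{V}^{d+1}}\mathsf{U}^{\mathsf J}_{\mathbf k,n}(x,t)\,\mathsf{V}^{\mathsf J}_{\mathbf j,n}(x,t)\,W_{\beta,\gamma,\mu}(x,t)\,dx\,dt=\mathbf k!\,(n-k)!\,(-1)^n\frac{(\mu+\frac12)_k\,(2\mu+\beta+d)_{n+k}\,(\gamma+1)_{n-k}}{(\mu+\frac{d+1}2)_k\,(2\mu+\beta+\gamma+d+1)_{2n}}\,\delta_{\mathbf k,\mathbf j}$$ holds if either $k\ge j$, or $j>k$ and $\mathbf j-\mathbf k$ has an odd component.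
   Context: $\mathbb{V}^{d+1}=\{(x,t):\|x\|\le t,\ x\in\mathbb{R}^d,\ 0\le t\le1\}$, $W_{\beta,\gamma,\mu}(x,t)=(t^2-\|x\|^2)^{\mu-\frac12}t^\beta(1-t)^\gamma$, and $$b^J_{\beta,\gamma,\mu}=\Bigl(\int_{\mathbb{V}^{d+1}}W_{\beta,\gamma,\mu}\,dx\,dt\Bigr)^{-1}=\frac{\Gamma(2\mu+\beta+\gamma+d+1)}{\Gamma(2\mu+\beta+d)\Gamma(\gamma+1)}\cdot\frac{\Gamma(\mu+\frac{d+1}2)}{\pi^{d/2}\Gamma(\mu+\frac12)}.$$ $\mathcal{V}_n(\mathbb{V}^{d+1},W_{\beta,\gamma,\mu})$ is the space of polynomials of degree at most $n$ in $(x,t)$ orthogonal to all polynomials of degree at most $n-1$ with respect to $\langle f,g\rangle=\int_{\mathbb{V}^{d+1}}fg\,W_{\beta,\gamma,\mu}\,dx\,dt$. Notation: $|\mathbf k|=k_1+\cdots+k_d$, $\mathbf k!=k_1!\cdots k_d!$, $(a)_k=a(a+1)\cdots(a+k-1)$. For $\mathbf k\in\mathbb{N}_0^d$, $|\mathbf k|=k\le n$, $$\mathsf{U}^{\mathsf J}_{\mathbf k,n}(x,t)=\frac{1}{W_{\beta,\gamma,\mu}(x,t)}\,\frac{1}{t^{2k+2\mu+d-1}}\left[\frac{\partial^{\mathbf k}}{\partial x^{\mathbf k}}(t^2-\|x\|^2)^{k+\mu-\frac12}\right]\left[\frac{\partial^{n-k}}{\partial t^{n-k}}\bigl(t^{n+k+\beta+2\mu+d-1}(1-t)^{\gamma+n-k}\bigr)\right].$$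 $\mathsf{V}^{\mathsf J}_{\mathbf j,n}$, $|\mathbf j|\le n$, is the monomial orthogonal polynomial: the unique element of $\mathcal{V}_n(\mathbb{V}^{d+1},W_{\beta,\gamma,\mu})$ such that $\mathsf{V}^{\mathsf J}_{\mathbf j,n}(x,t)-t^{n-|\mathbf j|}x^{\mathbf j}$ is a polynomial of degree at most $n-1$ in $(x,t)$. *)

theory Defs
  imports "HOL-Analysis.Analysis"
begin

text \<open>Points $(x,t)$ of $R^{d+1}$ have type \<open>(real ^ 'n) \<times> real\<close>, where $d$ is \<open>CARD('n)\<close>;
  multi-indices are functions \<open>'n \<Rightarrow> nat\<close>.\<close>

definition mi_deg :: "('n::finite \<Rightarrow> nat) \<Rightarrow> nat" where
  "mi_deg k = (\<Sum>i\<in>UNIV. k i)"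

definition mi_fact :: "('n::finite \<Rightarrow> nat) \<Rightarrow> real" where
  "mi_fact k = (\<Prod>i\<in>UNIV. fact (k i))"

definition mi_power :: "real ^ 'n \<Rightarrow> ('n::finite \<Rightarrow> nat) \<Rightarrow> real" where
  "mi_power x k = (\<Prod>i\<in>UNIV. (x $ i) ^ k i)"

definition partial_deriv :: "'n::finite \<Rightarrow> (real ^ 'n \<Rightarrow> real) \<Rightarrow> real ^ 'n \<Rightarrow> real" where
  "partial_deriv i f x = deriv (\<lambda>s. f (x + s *\<^sub>R axis i 1)) 0"

text \<open>The finite index type carries no order, so the partial derivatives are taken along an
  arbitrary sequence of directions in which each \<open>i\<close> occurs exactly \<open>k i\<close> times; such a sequence
  exists by the lemma below, and for functions smooth near a point its choice does not affect
  the value there.\<close>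

definition mi_deriv :: "('n::finite \<Rightarrow> nat) \<Rightarrow> (real ^ 'n \<Rightarrow> real) \<Rightarrow> real ^ 'n \<Rightarrow> real" where
  "mi_deriv k f = foldr partial_deriv (SOME is. \<forall>i. count_list is i = k i) f"

lemma ex_direction_list:
  fixes k :: "'n::finite \<Rightarrow> nat"
  shows "\<exists>is. \<forall>i. count_list is i = k i"
proof -
  have "\<exists>is. \<forall>i. count_list is i = (if i \<in> A then k i else 0)" if "finite A" for A :: "'n set"
    using that
  proof (induction A rule: finite_induct)
    case empty
    then show ?case by (intro exI[of _ "[]"]) simp
  next
    case (insert a A)
    then obtain js where js: "\<forall>i. count_list js i = (if i \<in> A then k i else 0)" by blast
    have rep: "count_list (replicate m a) i = (if i = a then m else 0)" for m i
      by (induction m) auto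
    show ?case
      using js insert.hyps by (intro exI[of _ "replicate (k a) a @ js"]) (auto simp: rep)
  qed
  from this[of UNIV] show ?thesis by simp
qed

definition VV :: "((real ^ 'n::finite) \<times> real) set" where
  "VV = {(x, t). norm x \<le> t \<and> 0 \<le> t \<and> t \<le> 1}"

definition weight :: "real \<Rightarrow> real \<Rightarrow> real \<Rightarrow> (real ^ 'n::finite) \<times> real \<Rightarrow> real" where
  "weight \<beta> \<gamma> \<mu> = (\<lambda>(x, t).
     (t\<^sup>2 - (norm x)\<^sup>2) powr (\<mu> - 1/2) * t powr \<beta> * (1 - t) powr \<gamma>)"

definition cone_inner :: "real \<Rightarrow> real \<Rightarrow> real \<Rightarrow>
    ((real ^ 'n::finite) \<times> real \<Rightarrow> real) \<Rightarrow> ((real ^ 'n) \<times> real \<Rightarrow> real) \<Rightarrow> real" where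
  "cone_inner \<beta> \<gamma> \<mu> f g = (LINT p:VV|lborel. f p * g p * weight \<beta> \<gamma> \<mu> p)"

definition bJ :: "'n::finite itself \<Rightarrow> real \<Rightarrow> real \<Rightarrow> real \<Rightarrow> real" where
  "bJ _ \<beta> \<gamma> \<mu> =
     inverse (LINT p:(VV :: ((real ^ 'n) \<times> real) set)|lborel. weight \<beta> \<gamma> \<mu> p)"

definition cone_monomial :: "('n::finite \<Rightarrow> nat) \<Rightarrow> nat \<Rightarrow> (real ^ 'n) \<times> real \<Rightarrow> real" where
  "cone_monomial j i = (\<lambda>(x, t). t ^ i * mi_power x j)"

text \<open>Real polynomials in $(x,t)$ of total degree at most \<open>m\<close>, as functions on $R^{d+1}$. The bound
  is an integer so that \<open>m = -1\<close> leaves just the zero polynomial.\<close>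

definition polys_deg_le :: "int \<Rightarrow> ((real ^ 'n::finite) \<times> real \<Rightarrow> real) set" where
  "polys_deg_le m = {f. \<exists>c. f = (\<lambda>p.
     \<Sum>(j, i) \<in> {(j, i). int (mi_deg j + i) \<le> m}. c j i * cone_monomial j i p)}"

definition orth_polys ::
    "nat \<Rightarrow> real \<Rightarrow> real \<Rightarrow> real \<Rightarrow> ((real ^ 'n::finite) \<times> real \<Rightarrow> real) set" where
  "orth_polys n \<beta> \<gamma> \<mu> =
     {f \<in> polys_deg_le (int n). \<forall>g \<in> polys_deg_le (int n - 1). cone_inner \<beta> \<gamma> \<mu> f g = 0}"

text \<open>The formula for \<open>UJ\<close> is meaningful in the interior of the cone; its values on the boundary,
  a null set, are irrelevant.\<close>

definition UJ :: "real \<Rightarrow> real \<Rightarrow> real \<Rightarrow> ('n::finite \<Rightarrow> nat) \<Rightarrow> nat \<Rightarrow>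
    (real ^ 'n) \<times> real \<Rightarrow> real" where
  "UJ \<beta> \<gamma> \<mu> k n = (\<lambda>(x, t).
     1 / weight \<beta> \<gamma> \<mu> (x, t)
     * (1 / t powr (2 * real (mi_deg k) + 2 * \<mu> + real CARD('n) - 1))
     * mi_deriv k (\<lambda>y. (t\<^sup>2 - (norm y)\<^sup>2) powr (real (mi_deg k) + \<mu> - 1/2)) x
     * (deriv ^^ (n - mi_deg k))
         (\<lambda>s. s powr (real n + real (mi_deg k) + \<beta> + 2 * \<mu> + real CARD('n) - 1)
              * (1 - s) powr (\<gamma> + real n - real (mi_deg k))) t)"

definition VJ :: "real \<Rightarrow> real \<Rightarrow> real \<Rightarrow> ('n::finite \<Rightarrow> nat) \<Rightarrow> nat \<Rightarrow>
    (real ^ 'n) \<times> real \<Rightarrow> real" where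
  "VJ \<beta> \<gamma> \<mu> j n = (THE f. f \<in> orth_polys n \<beta> \<gamma> \<mu> \<and>
     (\<lambda>p. f p - cone_monomial j (n - mi_deg j) p) \<in> polys_deg_le (int n - 1))"

end

theory Submission
  imports Defs
begin

text \<open>Only the leading monomial of \<open>VJ\<close> matters. In the coordinates \<open>x = t y\<close> with \<open>y\<close> in the unit
  ball, the product of \<open>UJ\<close>, a monomial \<open>t ^ i * mi_power x j\<close> and the weight separates into a
  function of \<open>y\<close> times a function of \<open>t\<close>. Integration by parts in the ball moves the derivatives
  of \<open>UJ\<close> onto \<open>mi_power y j\<close>: the result vanishes unless \<open>k \<le> j\<close>, and by parity if
  \<open>j - k\<close> has an odd component. Integration by parts in \<open>t\<close> moves the \<open>n - mi_deg k\<close> derivatives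
  onto a power of \<open>t\<close> of degree \<open>mi_deg j + i - mi_deg k\<close>, which is too small if the monomial has
  degree below \<open>n\<close>. The constant is a quotient of Beta values and of integrals
  of \<open>(1 - (norm y)\<^sup>2) powr a\<close> over the ball.\<close>

section \<open>Integrals over the unit ball\<close>

text \<open>The weight may blow up on the boundary, so every integration by parts must come with
  integrability. Boundary terms do not arise, because derivatives are moved one at a time and each
  power of \<open>1 - (norm y)\<^sup>2\<close>, \<open>t\<close> or \<open>1 - t\<close> still has a
  positive exponent when it is differentiated. \<open>UJ\<close> is never expanded and never shown
  to be a polynomial: inside the cone the existence of polynomial factors is enough, and the
  integrability of its product with each monomial comes from the separated form. The ball integrals
  are not evaluated either. Integration by parts yields a recurrence in the exponent, and the
  remaining value at exponent \<open>\<mu> - 1/2\<close> cancels against \<open>bJ\<close>. The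
  biorthogonality is only partial for a visible reason: if \<open>k \<le> j\<close>,
  \<open>k \<noteq> j\<close> and all components of \<open>j - k\<close> are even, the ball factor
  integrates a nonnegative function and does not vanish.\<close>

lemma borel_measurable_indicator_ball [measurable]:
  "(indicator (ball c r :: 'a::euclidean_space set) :: 'a \<Rightarrow> ennreal) \<in> borel_measurable borel"
  "(indicator (ball c r) :: 'a \<Rightarrow> real) \<in> borel_measurable borel"
  by (intro borel_measurable_indicator borel_open open_ball)+

section \<open>Integrability of weights singular on the unit sphere\<close>

lemma one_minus_power_le:
  fixes t :: real assumes "0 \<le> t" "t \<le> 1"
  shows "1 - t ^ d \<le> real d * (1 - t)"
  using Bernoulli_inequality[of "t - 1" d] assms by (simp add: algebra_simps)

lemma nn_integral_one_minus_powr_finite: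
  fixes a :: real assumes "a > -1"
  shows "(\<integral>\<^sup>+ t. ennreal ((1 - t) powr a) * indicator {0..1} t \<partial>lborel) < \<infinity>"
proof -
  have "set_integrable lborel {0..1} (\<lambda>t::real. t powr (1 - 1) * (1 - t) powr ((a+1) - 1))"
    by (rule integrable_Beta) (use assms in auto)
  then have i: "integrable lborel (\<lambda>t::real. indicator {0..1} t * (t powr 0 * (1 - t) powr a))"
    by (simp add: set_integrable_def)
  have "(\<integral>\<^sup>+ t. ennreal ((1 - t) powr a) * indicator {0..1} t \<partial>lborel)
      = (\<integral>\<^sup>+ t. ennreal (norm (indicator {0..1} t * (t powr 0 * (1 - t) powr a) :: real)) \<partial>lborel)"
  \<comment> \<open>The Beta integrand carries \<open>t powr 0\<close>, which is 1 except at
    \<open>t = 0\<close>, where \<open>0 powr 0 = 0\<close>.\<close>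
  proof (rule nn_integral_cong_AE)
    show "AE t in lborel. ennreal ((1 - t) powr a) * indicator {0..1} t
       = ennreal (norm (indicator {0..1} t * (t powr 0 * (1 - t) powr a) :: real))"
      using AE_lborel_singleton[of "0::real"] by eventually_elim (auto simp: indicator_def)
  qed
  also have "\<dots> < \<infinity>"
    using i unfolding integrable_iff_bounded by blast
  finally show ?thesis .
qed

text \<open>Write \<open>(1 - r) powr a\<close> as the integral of its derivative over \<open>{0..r}\<close> and exchange the order of
  integration; the shell \<open>t \<le> norm y < 1\<close> has volume of order \<open>1 - t\<close>.\<close>

lemma nn_integral_ball_powr_finite:
  fixes a :: real
  assumes a: "a > -1" "a < 0"
  shows "(\<integral>\<^sup>+ y. ennreal ((1 - norm y) powr a) * indicator (ball 0 1) y \<partial>(lborel :: 'a::euclidean_space measure)) < \<infinity>"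
proof -
  define c where "c = unit_ball_vol (real DIM('a))"
  have c: "c \<ge> 0" unfolding c_def by simp
  define h where "h t = (- a) * (1 - t) powr (a - 1)" for t :: real
  have [measurable]: "h \<in> borel_measurable borel" unfolding h_def by measurable
  have h0: "h t \<ge> 0" for t using a by (simp add: h_def mult_nonpos_nonneg)
  have ftc: "ennreal ((1 - r) powr a) = 1 + (\<integral>\<^sup>+ t. ennreal (h t) * indicator {0..r} t \<partial>lborel)"
    if "0 \<le> r" "r < 1" for r :: real
  proof -
    have "(\<integral>\<^sup>+ t. ennreal (h t) * indicator {0..r} t \<partial>lborel) = ennreal ((1 - r) powr a - (1 - 0) powr a)"
    proof (rule nn_integral_FTC_Icc)
      fix t assume t: "t \<in> {0..r}"
      with that show "((\<lambda>t. (1 - t) powr a) has_real_derivative h t) (at t)"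
        by (auto intro!: derivative_eq_intros simp: h_def)
      show "h t \<ge> 0" by (rule h0)
    qed (use that in auto)
    moreover have "1 \<le> (1 - r) powr a"
      using that a powr_mono2'[of a "1 - r" 1] by simp
    ultimately show ?thesis
      by (simp flip: ennreal_plus ennreal_1)
  qed
  have vol: "emeasure lborel {y :: 'a. t \<le> norm y \<and> norm y < 1} \<le> ennreal (c * real DIM('a) * (1 - t))"
    if t: "0 \<le> t" "t \<le> 1" for t
  proof -
    have eq: "{y :: 'a. t \<le> norm y \<and> norm y < 1} = ball 0 1 - ball 0 t" by auto
    have "emeasure lborel (ball (0::'a) 1 - ball 0 t) = emeasure lborel (ball (0::'a) 1) - emeasure lborel (ball (0::'a) t)"
      using t by (intro emeasure_Diff) (auto simp: emeasure_ball)
    also have "\<dots> = ennreal (c * (1 - t ^ DIM('a)))"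
      using t c by (simp add: emeasure_ball c_def ennreal_minus right_diff_distrib)
    also have "\<dots> \<le> ennreal (c * real DIM('a) * (1 - t))"
      using mult_left_mono[OF one_minus_power_le[OF t, of "DIM('a)"] c] by (intro ennreal_leI) (simp add: mult.assoc)
    finally show ?thesis unfolding eq .
  qed
  have "(\<integral>\<^sup>+ y. ennreal ((1 - norm y) powr a) * indicator (ball 0 1) y \<partial>(lborel :: 'a measure))
     = (\<integral>\<^sup>+ y. indicator (ball 0 1) y + (\<integral>\<^sup>+ t. ennreal (h t) * indicator {0..1} t * indicator {y. t \<le> norm y \<and> norm y < 1} y \<partial>lborel) \<partial>(lborel :: 'a measure))"
  proof (rule nn_integral_cong)
    fix y :: 'a
    show "ennreal ((1 - norm y) powr a) * indicator (ball 0 1) y = indicator (ball 0 1) y + (\<integral>\<^sup>+ t. ennreal (h t) * indicator {0..1} t * indicator {y. t \<le> norm y \<and> norm y < 1} y \<partial>lborel)"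
    proof (cases "norm y < 1")
      case True
      then have "(\<integral>\<^sup>+ t. ennreal (h t) * indicator {0..1} t * indicator {y. t \<le> norm y \<and> norm y < 1} y \<partial>lborel)
          = (\<integral>\<^sup>+ t. ennreal (h t) * indicator {0..norm y} t \<partial>lborel)"
        by (intro nn_integral_cong) (auto simp: indicator_def)
      with True ftc[of "norm y"] show ?thesis by simp
    qed simp
  qed
  also have "\<dots> = emeasure lborel (ball (0::'a) 1) + (\<integral>\<^sup>+ y. (\<integral>\<^sup>+ t. ennreal (h t) * indicator {0..1} t * indicator {y. t \<le> norm y \<and> norm y < 1} y \<partial>lborel) \<partial>(lborel :: 'a measure))"
  proof (subst nn_integral_add)
    show "(\<lambda>y::'a. \<integral>\<^sup>+ t. ennreal (h t) * indicator {0..1} t * indicator {y. t \<le> norm y \<and> norm y < 1} y \<partial>lborel) \<in> borel_measurable lborel"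
      unfolding indicator_def by measurable
  qed (simp_all add: borel_measurable_indicator_ball)
  also have "(\<integral>\<^sup>+ y. (\<integral>\<^sup>+ t. ennreal (h t) * indicator {0..1} t * indicator {y. t \<le> norm y \<and> norm y < 1} y \<partial>lborel) \<partial>(lborel :: 'a measure))
    = (\<integral>\<^sup>+ t. (\<integral>\<^sup>+ y. ennreal (h t) * indicator {0..1} t * indicator {y. t \<le> norm y \<and> norm y < 1} y \<partial>(lborel :: 'a measure)) \<partial>lborel)"
    by (rule lborel_pair.Fubini') (simp add: indicator_def)
  also have "\<dots> = (\<integral>\<^sup>+ t. ennreal (h t) * indicator {0..1} t * emeasure lborel {y :: 'a. t \<le> norm y \<and> norm y < 1} \<partial>lborel)"
    by (subst nn_integral_cmult) (auto intro!: nn_integral_cong)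
  also have "\<dots> \<le> (\<integral>\<^sup>+ t. ennreal (c * real DIM('a) * (- a)) * (ennreal ((1 - t) powr a) * indicator {0..1} t) \<partial>lborel)"
  proof (rule nn_integral_mono)
    fix t :: real
    show "ennreal (h t) * indicator {0..1} t * emeasure lborel {y :: 'a. t \<le> norm y \<and> norm y < 1}
      \<le> ennreal (c * real DIM('a) * (- a)) * (ennreal ((1 - t) powr a) * indicator {0..1} t)"
    proof (cases "t \<in> {0..1}")
      case True
      then have "ennreal (h t) * emeasure lborel {y :: 'a. t \<le> norm y \<and> norm y < 1}
         \<le> ennreal (h t) * ennreal (c * real DIM('a) * (1 - t))"
        by (intro mult_left_mono vol) auto
      also have "\<dots> = ennreal (h t * (c * real DIM('a) * (1 - t)))"
        using h0[of t] by (simp flip: ennreal_mult')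
      also have "h t * (c * real DIM('a) * (1 - t)) = c * real DIM('a) * (- a) * (1 - t) powr a"
      proof (cases "t = 1")
        case False
        with True have "(1 - t) powr a = (1 - t) powr (a - 1) * (1 - t)" by (simp add: powr_diff)
        then show ?thesis by (simp add: h_def)
      qed (simp add: h_def)
      also have "ennreal \<dots> = ennreal (c * real DIM('a) * (- a)) * ennreal ((1 - t) powr a)"
        using a c by (intro ennreal_mult mult_nonneg_nonneg) auto
      finally show ?thesis using True by simp
    qed simp
  qed
  also have "\<dots> = ennreal (c * real DIM('a) * (- a)) * (\<integral>\<^sup>+ t. (ennreal ((1 - t) powr a) * indicator {0..1} t) \<partial>lborel)"
    by (rule nn_integral_cmult) simp
  finally have "(\<integral>\<^sup>+ y. ennreal ((1 - norm y) powr a) * indicator (ball 0 1) y \<partial>(lborel :: 'a measure))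
     \<le> emeasure lborel (ball (0::'a) 1) + ennreal (c * real DIM('a) * (- a)) * (\<integral>\<^sup>+ t. (ennreal ((1 - t) powr a) * indicator {0..1} t) \<partial>lborel)" by (simp add: add_left_mono)
  also have "\<dots> < \<infinity>"
    using nn_integral_one_minus_powr_finite[OF a(1)] by (simp add: emeasure_ball ennreal_mult_less_top)
  finally show ?thesis .
qed

text \<open>For negative \<open>a\<close> the bound
  \<open>1 - (norm y)\<^sup>2 \<ge> 1 - norm y\<close> reduces to a power of the distance to the
  sphere. The exponent \<open>min a (-1/2)\<close> lies strictly between -1 and 0, the range for
  which finiteness is known, and the summand 1 covers nonnegative \<open>a\<close>.\<close>

lemma powr_one_minus_norm_square_le:
  assumes "a > -1" "norm (y::'a::euclidean_space) < 1"
  shows "(1 - (norm y)\<^sup>2) powr a \<le> 1 + (1 - norm y) powr (min a (-1/2))"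
proof (cases "a \<ge> 0")
  case True
  have "(1 - (norm y)\<^sup>2) powr a \<le> 1 powr a"
    using True assms by (intro powr_mono2) (auto simp: power_le_one)
  then show ?thesis by (simp add: add_increasing2)
next
  case False
  have "(norm y)\<^sup>2 \<le> norm y" using assms by (simp add: power2_eq_square mult_left_le_one_le)
  then have "(1 - (norm y)\<^sup>2) powr a \<le> (1 - norm y) powr a"
    using False assms by (intro powr_mono2') auto
  also have "\<dots> \<le> (1 - norm y) powr (min a (-1/2))"
    using assms by (intro powr_mono') auto
  finally show ?thesis by simp
qed

lemma integrable_ball_powr_poly:
  fixes q :: "real ^ 'n::finite \<Rightarrow> real"
  assumes a: "a > -1" and q: "continuous_on UNIV q"
  shows "integrable lborel (\<lambda>y. indicator (ball 0 1) y * ((1 - (norm y)\<^sup>2) powr a * q y))"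
proof -
  have [measurable]: "q \<in> borel_measurable borel"
    using q by (rule borel_measurable_continuous_onI)
  have "compact (q ` cball 0 1)"
    using q by (intro compact_continuous_image) (auto intro: continuous_on_subset)
  then obtain M where M: "\<And>y. norm y \<le> 1 \<Longrightarrow> \<bar>q y\<bar> \<le> M"
    by (metis bounded_iff compact_imp_bounded imageI mem_cball_0 real_norm_def)
  have M0: "M \<ge> 0" using M[of 0] by simp
  let ?b = "min a (-1/2)"
  show ?thesis
  proof (rule integrableI_bounded)
    have "(\<integral>\<^sup>+ y. ennreal (norm (indicator (ball 0 1) y * ((1 - (norm y)\<^sup>2) powr a * q y))) \<partial>lborel)
      \<le> (\<integral>\<^sup>+ y. ennreal M * (indicator (ball 0 1) y + ennreal ((1 - norm y) powr ?b) * indicator (ball 0 1) y) \<partial>(lborel :: (real^'n) measure))"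
    proof (rule nn_integral_mono)
      fix y :: "real ^ 'n"
      show "ennreal (norm (indicator (ball 0 1) y * ((1 - (norm y)\<^sup>2) powr a * q y)))
         \<le> ennreal M * (indicator (ball 0 1) y + ennreal ((1 - norm y) powr ?b) * indicator (ball 0 1) y)"
      proof (cases "norm y < 1")
        case True
        have "(1 - (norm y)\<^sup>2) powr a * \<bar>q y\<bar> \<le> (1 + (1 - norm y) powr ?b) * M"
          using True by (intro mult_mono powr_one_minus_norm_square_le a M) auto
        then show ?thesis using True M0
          by (auto simp: abs_mult mult.commute simp flip: ennreal_1 ennreal_plus ennreal_mult' intro!: ennreal_leI)
      qed simp
    qed
    also have "\<dots> = ennreal M * (emeasure lborel (ball (0::real^'n) 1) + (\<integral>\<^sup>+ y. ennreal ((1 - norm y) powr ?b) * indicator (ball 0 1) y \<partial>(lborel :: (real^'n) measure)))"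
      by (subst nn_integral_cmult, simp, subst nn_integral_add) simp_all
    also have "\<dots> < \<infinity>"
      using nn_integral_ball_powr_finite[of ?b, where 'a = "real^'n"] a
      by (auto simp: emeasure_ball ennreal_mult_less_top)
    finally show "(\<integral>\<^sup>+ y. ennreal (norm (indicator (ball 0 1) y * ((1 - (norm y)\<^sup>2) powr a * q y))) \<partial>lborel) < \<infinity>" .
  qed simp
qed

section \<open>Integration by parts on the ball\<close>

lemma integral_directional_derivative_zero:
  fixes f g :: "'a::euclidean_space \<Rightarrow> real"
  assumes f: "integrable lborel f" and g: "integrable lborel g"
    and cont: "\<And>y. continuous_on UNIV (\<lambda>s. f (y + s *\<^sub>R e))"
    and deriv: "\<And>y. \<exists>S. finite S \<and> (\<forall>s. s \<notin> S \<longrightarrow>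
       ((\<lambda>s. f (y + s *\<^sub>R e)) has_real_derivative g (y + s *\<^sub>R e)) (at s))"
  shows "integral\<^sup>L lborel g = 0"
proof -
  \<comment> \<open>Translation invariance: integrating \<open>g (y + s *\<^sub>R e)\<close> over \<open>s\<close> first gives \<open>f (y + e) - f y\<close>,
    over \<open>y\<close> first gives the integral of \<open>g\<close>.\<close>
  define G where "G = (\<lambda>(s, y). indicator {0..1::real} s * g (y + s *\<^sub>R e))"
  have [measurable]: "g \<in> borel_measurable borel" "f \<in> borel_measurable borel"
    using f g by auto
  have shift: "integrable lborel (\<lambda>y. h (y + c))" "(\<integral>y. h (y + c) \<partial>lborel) = integral\<^sup>L lborel h"
    if h: "integrable lborel h" for h :: "'a \<Rightarrow> real" and c :: 'a
  proof -
    have [measurable]: "h \<in> borel_measurable borel" using h by auto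
    have d: "distr lborel borel ((+) c) = (lborel :: 'a measure)" by (rule lborel_distr_plus)
    have "integrable (distr lborel borel ((+) c)) h" unfolding d by (rule h)
    then show "integrable lborel (\<lambda>y. h (y + c))"
      by (subst (asm) integrable_distr_eq) (auto simp: add.commute)
    have "integral\<^sup>L (distr lborel borel ((+) c)) h = (\<integral>y. h (y + c) \<partial>lborel)"
      by (subst integral_distr) (auto simp: add.commute)
    then show "(\<integral>y. h (y + c) \<partial>lborel) = integral\<^sup>L lborel h" unfolding d by simp
  qed
  have Gint: "integrable (lborel \<Otimes>\<^sub>M lborel) G"
  proof (rule lborel_pair.Fubini_integrable)
    show "G \<in> borel_measurable (lborel \<Otimes>\<^sub>M lborel)" unfolding G_def by measurable
    have "(\<integral>y. norm (G (s, y)) \<partial>lborel) = indicator {0..1} s * (\<integral>y. \<bar>g y\<bar> \<partial>lborel)" for s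
      using shift(2)[OF integrable_abs[OF g], of "s *\<^sub>R e"] by (simp add: G_def abs_mult)
    then show "integrable lborel (\<lambda>s. \<integral>y. norm (G (s, y)) \<partial>lborel)" by simp
    show "AE s in lborel. integrable lborel (\<lambda>y. G (s, y))"
      by (rule AE_I2) (use shift(1)[OF g] in \<open>auto simp: G_def\<close>)
  qed
  have "integral\<^sup>L lborel g = (\<integral>s. indicator {0..1} s * integral\<^sup>L lborel g \<partial>(lborel :: real measure))"
    by simp
  also have "\<dots> = (\<integral>s. (\<integral>y. G (s, y) \<partial>lborel) \<partial>lborel)"
    using shift(2)[OF g] by (simp add: G_def)
  also have "\<dots> = (\<integral>y. (\<integral>s. G (s, y) \<partial>lborel) \<partial>lborel)"
    using lborel_pair.Fubini_integral[of "\<lambda>s y. G (s, y)"] Gint by simp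
  also have "\<dots> = (\<integral>y. f (y + e) - f y \<partial>lborel)"
  proof (rule integral_cong_AE)
    \<comment> \<open>The fundamental theorem of calculus gives a gauge integral along the segment.
      It agrees with the Lebesgue integral where the latter converges absolutely, which Fubini
      guarantees for almost every \<open>y\<close>.\<close>
    have "AE y in lborel. integrable lborel (\<lambda>s. G (s, y))"
      using lborel_pair.AE_integrable_snd[of "\<lambda>s y. G (s, y)"] Gint by simp
    then show "AE y in lborel. (\<integral>s. G (s, y) \<partial>lborel) = f (y + e) - f y"
    proof eventually_elim
      case (elim y)
      then have "set_integrable lborel {0..1} (\<lambda>s. g (y + s *\<^sub>R e))"
        by (simp add: set_integrable_def G_def)
      then have "(\<integral>s. G (s, y) \<partial>lborel) = integral {0..1} (\<lambda>s. g (y + s *\<^sub>R e))"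
        using set_borel_integral_eq_integral(2)[of "{0..1}" "\<lambda>s. g (y + s *\<^sub>R e)"]
        by (simp add: set_lebesgue_integral_def G_def)
      also have "((\<lambda>s. g (y + s *\<^sub>R e)) has_integral f (y + 1 *\<^sub>R e) - f (y + 0 *\<^sub>R e)) {0..1}"
      proof -
        obtain S where S: "finite S" "\<And>s. s \<notin> S \<Longrightarrow>
           ((\<lambda>s. f (y + s *\<^sub>R e)) has_real_derivative g (y + s *\<^sub>R e)) (at s)"
          using deriv[of y] by blast
        show ?thesis
          by (rule fundamental_theorem_of_calculus_interior_strong[OF S(1)])
             (use S(2) cont in \<open>auto intro: continuous_on_subset simp: has_real_derivative_iff_has_vector_derivative\<close>)
      qed
      then have "integral {0..1} (\<lambda>s. g (y + s *\<^sub>R e)) = f (y + e) - f y"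
        by (simp add: integral_unique)
      finally show ?case .
    qed
    show "(\<lambda>y. \<integral>s. G (s, y) \<partial>lborel) \<in> borel_measurable lborel"
      unfolding G_def by measurable
  qed simp
  also have "\<dots> = 0"
    using shift[OF f] f by (subst Bochner_Integration.integral_diff) auto
  finally show ?thesis .
qed

definition ball_integral :: "real \<Rightarrow> (real ^ 'n::finite \<Rightarrow> real) \<Rightarrow> real" where
  "ball_integral a q = (\<integral>y. indicator (ball 0 1) y * ((1 - (norm y)\<^sup>2) powr a * q y) \<partial>lborel)"

lemma ball_integral_add:
  assumes "a > -1" "continuous_on UNIV p" "continuous_on UNIV q"
  shows "ball_integral a (\<lambda>y. p y + q y) = ball_integral a p + ball_integral a q"
  unfolding ball_integral_def
  using integrable_ball_powr_poly[OF assms(1,2)] integrable_ball_powr_poly[OF assms(1,3)]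
  by (simp add: distrib_left)

lemma ball_integral_cmult:
  "ball_integral a (\<lambda>y. c * q y) = c * ball_integral a q"
proof -
  have "indicator (ball 0 1) y * ((1 - (norm y)\<^sup>2) powr a * (c * q y))
      = c * (indicator (ball 0 1) y * ((1 - (norm y)\<^sup>2) powr a * q y))" for y by simp
  then show ?thesis unfolding ball_integral_def by (simp only: integral_mult_right_zero)
qed

lemma ball_integral_sum:
  assumes "a > -1" "finite I" "\<And>i. i \<in> I \<Longrightarrow> continuous_on UNIV (p i)"
  shows "ball_integral a (\<lambda>y. \<Sum>i\<in>I. p i y) = (\<Sum>i\<in>I. ball_integral a (p i))"
  using assms(2,3)
proof (induction I rule: finite_induct)
  case empty
  show ?case by (simp add: ball_integral_def)
next
  case (insert i I)
  then show ?case by (simp add: ball_integral_add[OF assms(1)] continuous_on_sum)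
qed

lemma ball_integral_one_minus_norm_square:
  fixes q :: "real ^ 'n::finite \<Rightarrow> real"
  shows "ball_integral a (\<lambda>y. (1 - (norm y)\<^sup>2) * q y) = ball_integral (a + 1) q"
  unfolding ball_integral_def
proof (intro Bochner_Integration.integral_cong refl)
  fix y :: "real ^ 'n"
  show "indicator (ball 0 1) y * ((1 - (norm y)\<^sup>2) powr a * ((1 - (norm y)\<^sup>2) * q y))
     = indicator (ball 0 1) y * ((1 - (norm y)\<^sup>2) powr (a + 1) * q y)"
    by (cases "norm y < 1") (auto simp: powr_add abs_square_less_1 less_imp_le)
qed

lemma norm_line_square:
  "(norm (y + s *\<^sub>R axis i (1::real)))\<^sup>2 = (norm y)\<^sup>2 + 2 * s * y $ i + s\<^sup>2"
  unfolding power2_norm_eq_inner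
  by (simp add: inner_add inner_axis inner_axis' algebra_simps power2_eq_square)

lemma DERIV_line_one_minus_norm_square:
  "((\<lambda>s. 1 - (norm (y + s *\<^sub>R axis i (1::real)))\<^sup>2) has_real_derivative (- 2 * (y + s *\<^sub>R axis i 1) $ i)) (at s)"
  unfolding norm_line_square by (auto intro!: derivative_eq_intros)

text \<open>The function \<open>(1 - (norm y)\<^sup>2) powr a * q y\<close>, extended by zero, is
  continuous because \<open>a > 0\<close>, so its axial derivative integrates to 0 over the whole
  space. The differentiated power has exponent \<open>a - 1 > -1\<close> and is still integrable;
  separating the two summands of the product rule gives the identity.\<close>

lemma ball_integral_by_parts:
  fixes q q' :: "real ^ 'n::finite \<Rightarrow> real"
  assumes a: "a > 0" and q: "continuous_on UNIV q" and q': "continuous_on UNIV q'"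
    and deriv: "\<And>y s. ((\<lambda>s. q (y + s *\<^sub>R axis i 1)) has_real_derivative q' (y + s *\<^sub>R axis i 1)) (at s)"
  shows "2 * a * ball_integral (a - 1) (\<lambda>y. y $ i * q y) = ball_integral a q'"
proof -
  define f where "f y = indicator (ball 0 1) y * ((1 - (norm y)\<^sup>2) powr a * q y)" for y :: "real ^ 'n"
  define g where "g y = (- 2 * a) * (indicator (ball 0 1) y * ((1 - (norm y)\<^sup>2) powr (a - 1) * (y $ i * q y)))
      + indicator (ball 0 1) y * ((1 - (norm y)\<^sup>2) powr a * q' y)" for y :: "real ^ 'n"
  have cq: "continuous_on UNIV (\<lambda>y. y $ i * q y)"
    using q by (intro continuous_intros)
  have i1: "integrable lborel (\<lambda>y. indicator (ball 0 1) y * ((1 - (norm y)\<^sup>2) powr (a - 1) * (y $ i * q y)))"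
    using a cq by (intro integrable_ball_powr_poly) auto
  have i2: "integrable lborel (\<lambda>y. indicator (ball 0 1) y * ((1 - (norm y)\<^sup>2) powr a * q' y))"
    using a q' by (intro integrable_ball_powr_poly) auto
  have "integral\<^sup>L lborel g = 0"
  proof (rule integral_directional_derivative_zero[where f = f and e = "axis i 1"])
    show "integrable lborel f"
      unfolding f_def using a q by (intro integrable_ball_powr_poly) auto
    show "integrable lborel g"
      unfolding g_def using i1 i2 by auto
    fix y :: "real ^ 'n"
    \<comment> \<open>Since \<open>0 powr a = 0\<close>, clipping the base at 0 is the same as
      extending by zero, and in this form continuity needs no case distinction.\<close>
    have f_eq: "f y = (max 0 (1 - (norm y)\<^sup>2)) powr a * q y" for y
      using a by (auto simp: f_def indicator_def abs_square_less_1 max_def not_less abs_le_square_iff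
          power_le_one_iff)
    have ql: "continuous_on UNIV (\<lambda>s. q (y + s *\<^sub>R axis i 1))"
      by (rule continuous_on_compose2[OF q]) (auto intro!: continuous_intros)
    show "continuous_on UNIV (\<lambda>s. f (y + s *\<^sub>R axis i 1))"
      unfolding f_eq using a
      by (intro continuous_on_mult ql continuous_on_powr' continuous_intros) auto
    \<comment> \<open>A line parallel to the axis meets the unit sphere at the zeros of a monic
      quadratic in \<open>s\<close>. This finite set contains all points where differentiability may
      fail.\<close>
    define S where "S = {s. poly [:(norm y)\<^sup>2 - 1, 2 * y $ i, 1:] s = 0}"
    have S: "finite S" unfolding S_def by (rule poly_roots_finite) simp
    have S': "norm (y + s *\<^sub>R axis i (1::real)) \<noteq> 1" if "s \<notin> S" for s
    proof
      assume "norm (y + s *\<^sub>R axis i (1::real)) = 1"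
      then have "(norm (y + s *\<^sub>R axis i (1::real)))\<^sup>2 = 1" by simp
      then have "s \<in> S"
        unfolding norm_line_square S_def by (simp add: algebra_simps power2_eq_square)
      with that show False by simp
    qed
    have "((\<lambda>s. f (y + s *\<^sub>R axis i 1)) has_real_derivative g (y + s *\<^sub>R axis i 1)) (at s)"
      if s: "s \<notin> S" for s
    proof (cases "norm (y + s *\<^sub>R axis i (1::real)) < 1")
      case True
      have op: "open {s. norm (y + s *\<^sub>R axis i (1::real)) < 1}"
        by (intro open_Collect_less continuous_intros)
      have pos: "1 - (norm (y + s *\<^sub>R axis i (1::real)))\<^sup>2 > 0"
        using True by (simp add: abs_square_less_1)
      have "((\<lambda>s. (1 - (norm (y + s *\<^sub>R axis i 1))\<^sup>2) powr a * q (y + s *\<^sub>R axis i 1))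
        has_real_derivative g (y + s *\<^sub>R axis i 1)) (at s)"
        by (rule DERIV_cong[OF DERIV_mult[OF DERIV_fun_powr[OF DERIV_line_one_minus_norm_square pos] deriv]])
           (use True in \<open>simp add: g_def algebra_simps\<close>)
      then show ?thesis
        by (rule has_field_derivative_transform_within_open[OF _ op]) (use True in \<open>auto simp: f_def\<close>)
    next
      case False
      with S'[OF s] have gt: "norm (y + s *\<^sub>R axis i (1::real)) > 1" by simp
      have op: "open {s. norm (y + s *\<^sub>R axis i (1::real)) > 1}"
        by (intro open_Collect_less continuous_intros)
      have "((\<lambda>s. 0) has_real_derivative g (y + s *\<^sub>R axis i 1)) (at s)"
        using gt by (simp add: g_def)
      then show ?thesis
        by (rule has_field_derivative_transform_within_open[OF _ op]) (use gt in \<open>auto simp: f_def\<close>)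
    qed
    with S show "\<exists>S. finite S \<and> (\<forall>s. s \<notin> S \<longrightarrow>
       ((\<lambda>s. f (y + s *\<^sub>R axis i 1)) has_real_derivative g (y + s *\<^sub>R axis i 1)) (at s))"
      by blast
  qed
  also have "integral\<^sup>L lborel g = (- 2 * a) * ball_integral (a - 1) (\<lambda>y. y $ i * q y) + ball_integral a q'"
    unfolding g_def ball_integral_def using i1 i2 by simp
  finally show ?thesis by simp
qed

section \<open>Iterated partial derivatives in the ball\<close>

lemma real_polynomial_function_norm_square [intro]:
  "real_polynomial_function (\<lambda>y :: 'a::euclidean_space. (norm y)\<^sup>2)"
proof -
  have eq: "(\<lambda>y :: 'a. (norm y)\<^sup>2) = (\<lambda>y. \<Sum>b\<in>Basis. (y \<bullet> b) ^ 2)"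
    unfolding power2_norm_eq_inner by (simp add: fun_eq_iff power2_eq_square flip: euclidean_inner)
  show ?thesis
    unfolding eq
    by (intro real_polynomial_function_sum real_polynomial_function_power
        real_polynomial_function.intros(1) bounded_linear_inner_left finite_Basis)
qed

lemma real_polynomial_function_nth [intro]:
  "real_polynomial_function (\<lambda>y :: real ^ 'n::finite. y $ i)"
  by (intro real_polynomial_function.intros(1) bounded_linear_vec_nth)

lemma real_polynomial_function_mi_power [intro]:
  "real_polynomial_function (\<lambda>y :: real ^ 'n::finite. mi_power y j)"
  unfolding mi_power_def
  by (intro real_polynomial_function_prod real_polynomial_function_power real_polynomial_function_nth) auto

lemma real_polynomial_function_continuous_on:
  "real_polynomial_function q \<Longrightarrow> continuous_on S q"
  by (simp add: continuous_on_polymonial_function real_polynomial_function_eq)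

text \<open>Existence of a polynomial derivative suffices, since the polynomial factors of iterated
  derivatives are never written out. One function \<open>q'\<close> has to serve all lines in the
  direction \<open>e\<close> at once.\<close>

lemma real_polynomial_function_directional_derivative:
  assumes "real_polynomial_function q"
  shows "\<exists>q'. real_polynomial_function q' \<and>
    (\<forall>y s. ((\<lambda>s. q (y + s *\<^sub>R e)) has_real_derivative q' (y + s *\<^sub>R e)) (at s))"
  using assms
proof (induction q rule: real_polynomial_function.induct)
  case (linear f)
  interpret bounded_linear f by fact
  have "((\<lambda>s. f (y + s *\<^sub>R e)) has_real_derivative f e) (at s)" for y s
    unfolding add scaleR by (auto intro!: derivative_eq_intros)
  then show ?case by (intro exI[of _ "\<lambda>_. f e"]) (auto intro: real_polynomial_function.intros(2))
next
  case (const c)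
  show ?case by (intro exI[of _ "\<lambda>_. 0"]) (auto intro: real_polynomial_function.intros(2))
next
  case (add f g)
  then obtain f' g' where "real_polynomial_function f'" "real_polynomial_function g'"
    "\<And>y s. ((\<lambda>s. f (y + s *\<^sub>R e)) has_real_derivative f' (y + s *\<^sub>R e)) (at s)"
    "\<And>y s. ((\<lambda>s. g (y + s *\<^sub>R e)) has_real_derivative g' (y + s *\<^sub>R e)) (at s)"
    by blast
  then show ?case
    by (intro exI[of _ "\<lambda>y. f' y + g' y"]) (auto intro: real_polynomial_function.intros(3) DERIV_add)
next
  case (mult f g)
  then obtain f' g' where *: "real_polynomial_function f'" "real_polynomial_function g'"
    "\<And>y s. ((\<lambda>s. f (y + s *\<^sub>R e)) has_real_derivative f' (y + s *\<^sub>R e)) (at s)"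
    "\<And>y s. ((\<lambda>s. g (y + s *\<^sub>R e)) has_real_derivative g' (y + s *\<^sub>R e)) (at s)"
    by blast
  have "real_polynomial_function (\<lambda>y. f' y * g y + g' y * f y)"
    using * mult by (intro real_polynomial_function.intros(3) real_polynomial_function.intros(4))
  with *(3,4) show ?case
    by (intro exI[of _ "\<lambda>y. f' y * g y + g' y * f y"]) (auto intro: DERIV_mult)
qed

section \<open>Moments of the ball weight\<close>

lemma mi_power_remove:
  "mi_power y j = (y $ i) ^ j i * (\<Prod>l\<in>UNIV - {i}. (y $ l) ^ j l)"
  unfolding mi_power_def by (subst prod.remove[of _ i]) auto

lemma DERIV_mi_power_line:
  "((\<lambda>s. mi_power (y + s *\<^sub>R axis i 1) j) has_real_derivative
     real (j i) * mi_power (y + s *\<^sub>R axis i 1) (j(i := j i - 1))) (at s)"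
proof -
  have eq: "mi_power (y + s *\<^sub>R axis i 1) j' = (y $ i + s) ^ j' i * (\<Prod>l\<in>UNIV - {i}. (y $ l) ^ j' l)" for s j'
    unfolding mi_power_remove[of _ j' i]
    by (intro arg_cong2[where f = "(*)"] prod.cong) (auto simp: axis_def)
  show ?thesis
    unfolding eq by (auto intro!: derivative_eq_intros prod.cong)
qed

lemma mi_power_Suc:
  assumes "j i > 0"
  shows "mi_power y j = y $ i * mi_power y (j(i := j i - 1))"
  using assms unfolding mi_power_remove[of y _ i]
  by (auto simp: power_eq_if intro!: prod.cong)

text \<open>Integration by parts trades \<open>m i\<close> for \<open>m i - 2\<close> at the price
  of a larger exponent. An odd \<open>m i\<close> descends to 1, where the factor
  \<open>m i - 1\<close> is 0. This takes the place of the reflection in the \<open>i\<close>-th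
  coordinate.\<close>

lemma ball_integral_odd_moment:
  fixes m :: "'n::finite \<Rightarrow> nat"
  assumes "a > -1" "odd (m i)"
  shows "ball_integral a (\<lambda>y. mi_power y m) = 0"
  using assms
proof (induction "m i" arbitrary: m a rule: less_induct)
  case less
  let ?m = "m(i := m i - 1)"
  have pos: "m i > 0" using less.prems(2) by presburger
  have "2 * (a + 1) * ball_integral (a + 1 - 1) (\<lambda>y. y $ i * mi_power y ?m)
     = ball_integral (a + 1) (\<lambda>y. real (?m i) * mi_power y (?m(i := ?m i - 1)))"
    using less.prems(1) DERIV_mi_power_line[of _ i ?m]
    by (intro ball_integral_by_parts real_polynomial_function_continuous_on
        real_polynomial_function.intros(4) real_polynomial_function.intros(2) real_polynomial_function_mi_power) auto
  also have "\<dots> = real (m i - 1) * ball_integral (a + 1) (\<lambda>y. mi_power y (m(i := m i - 2)))"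
    by (simp add: ball_integral_cmult numeral_2_eq_2)
  also have "\<dots> = 0"
  proof (cases "m i = 1")
    case False
    with less.prems(2) have "odd (m i - 2)" "m i - 2 < m i" by presburger+
    with less.hyps[of "m(i := m i - 2)" "a + 1"] less.prems(1) show ?thesis by simp
  qed simp
  finally show ?case
    using less.prems(1) by (simp add: mi_power_Suc[where i = i and j = m, OF pos])
qed

text \<open>Integration by parts with \<open>q y = y $ i\<close> expresses the integral of
  \<open>y $ i * y $ i\<close> through the one with exponent \<open>a + 1\<close>. Summing over
  \<open>i\<close> produces \<open>(norm y)\<^sup>2 = 1 - (1 - (norm y)\<^sup>2)\<close>, and the
  last factor raises the exponent again, which closes the recurrence.\<close>

lemma ball_integral_one_step:
  fixes a :: real
  assumes "a > -1"
  shows "(a + 1 + real CARD('n) / 2) * ball_integral (a + 1) (\<lambda>_ :: real ^ 'n::finite. 1)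
    = (a + 1) * ball_integral a (\<lambda>_ :: real ^ 'n. 1)"
proof -
  let ?I = "\<lambda>a q. ball_integral a (q :: real ^ 'n \<Rightarrow> real)"
  have "2 * (a + 1) * ?I (a + 1 - 1) (\<lambda>y. y $ i * y $ i) = ?I (a + 1) (\<lambda>_. 1)" for i
    using assms by (intro ball_integral_by_parts) (auto intro!: derivative_eq_intros continuous_intros)
  then have "(\<Sum>i::'n\<in>UNIV. 2 * (a + 1) * ?I a (\<lambda>y. y $ i * y $ i)) = (\<Sum>i::'n\<in>UNIV. ?I (a + 1) (\<lambda>_. 1))"
    by (intro sum.cong) auto
  moreover have "(\<Sum>i::'n\<in>UNIV. 2 * (a + 1) * ?I a (\<lambda>y. y $ i * y $ i))
     = 2 * (a + 1) * ?I a (\<lambda>y. \<Sum>i::'n\<in>UNIV. y $ i * y $ i)"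
    using assms by (subst ball_integral_sum) (auto simp: sum_distrib_left intro!: continuous_intros)
  moreover have "?I a (\<lambda>y. \<Sum>i::'n\<in>UNIV. y $ i * y $ i) = ?I a (\<lambda>y. 1 + (-1) * ((1 - (norm y)\<^sup>2) * 1))"
    by (simp add: power2_norm_eq_inner inner_vec_def)
  moreover have "\<dots> = ?I a (\<lambda>_. 1) + ?I a (\<lambda>y. (-1) * ((1 - (norm y)\<^sup>2) * 1))"
    by (rule ball_integral_add) (use assms in \<open>auto intro!: continuous_intros\<close>)
  moreover have "\<dots> = ?I a (\<lambda>_. 1) - ?I (a + 1) (\<lambda>_. 1)"
    unfolding ball_integral_cmult ball_integral_one_minus_norm_square by simp
  ultimately have "real CARD('n) * ?I (a + 1) (\<lambda>_. 1) = 2 * (a + 1) * (?I a (\<lambda>_. 1) - ?I (a + 1) (\<lambda>_. 1))"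
    by (simp only: sum_constant)
  then show ?thesis by (simp add: field_simps)
qed

text \<open>At \<open>a = \<mu> - 1/2\<close> the two Pochhammer bases become \<mu> + (d+1)/2 and
  \<mu> + 1/2: this is the contribution of the ball to the final constant. The product form avoids
  the value of the ball integral.\<close>

lemma ball_integral_one_pochhammer:
  fixes a :: real
  assumes "a > -1"
  shows "pochhammer (a + 1 + real CARD('n) / 2) k * ball_integral (a + real k) (\<lambda>_ :: real ^ 'n::finite. 1)
    = pochhammer (a + 1) k * ball_integral a (\<lambda>_ :: real ^ 'n. 1)"
proof (induction k)
  case (Suc k)
  let ?I = "\<lambda>a. ball_integral a (\<lambda>_ :: real ^ 'n. 1)"
  have "(a + k + 1 + real CARD('n) / 2) * ?I (a + k + 1) = (a + k + 1) * ?I (a + k)"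
    using assms by (intro ball_integral_one_step) auto
  then have "pochhammer (a + 1 + real CARD('n) / 2) k * ((a + 1 + real CARD('n) / 2 + k) * ?I (a + Suc k))
     = (a + 1 + k) * (pochhammer (a + 1 + real CARD('n) / 2) k * ?I (a + k))"
    by (simp add: algebra_simps)
  with Suc show ?case by (simp add: pochhammer_Suc algebra_simps)
qed simp

section \<open>Rodrigues-type formula in the ball and its dilations\<close>

lemma partial_deriv_eqI:
  fixes f g :: "real ^ 'n::finite \<Rightarrow> real"
  assumes "open U" "x \<in> U" "\<And>y. y \<in> U \<Longrightarrow> f y = g y"
    and "((\<lambda>s. g (x + s *\<^sub>R axis i 1)) has_real_derivative D) (at 0)"
  shows "partial_deriv i f x = D"
proof -
  have op: "open ((\<lambda>s. x + s *\<^sub>R axis i 1) -` U)"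
    using assms(1) by (intro open_vimage continuous_intros)
  have "((\<lambda>s. f (x + s *\<^sub>R axis i 1)) has_real_derivative D) (at 0)"
    by (rule has_field_derivative_transform_within_open[OF assms(4) op]) (use assms(2,3) in auto)
  then show ?thesis unfolding partial_deriv_def by (rule DERIV_imp_deriv)
qed

text \<open>A power of \<open>1 - (norm y)\<^sup>2\<close> times a polynomial keeps this form under
  a partial derivative: one factor is split off the undifferentiated power, so that both summands
  share the exponent \<open>b - 1\<close>.\<close>

lemma DERIV_ball_powr_poly:
  fixes q q' :: "real ^ 'n::finite \<Rightarrow> real"
  assumes y: "norm y < 1"
    and q: "\<And>y s. ((\<lambda>s. q (y + s *\<^sub>R axis i 1)) has_real_derivative q' (y + s *\<^sub>R axis i 1)) (at s)"
  shows "((\<lambda>s. (1 - (norm (y + s *\<^sub>R axis i 1))\<^sup>2) powr b * q (y + s *\<^sub>R axis i 1)) has_real_derivative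
     (1 - (norm y)\<^sup>2) powr (b - 1) * (- 2 * b * (y $ i * q y) + (1 - (norm y)\<^sup>2) * q' y)) (at 0)"
proof -
  have pos: "1 - (norm (y + 0 *\<^sub>R axis i (1::real)))\<^sup>2 > 0"
    using y by (simp add: abs_square_less_1)
  then have eq: "(1 - (norm y)\<^sup>2) powr b = (1 - (norm y)\<^sup>2) powr (b - 1) * (1 - (norm y)\<^sup>2)"
    by (simp add: powr_diff)
  show ?thesis
  proof (rule DERIV_cong[OF DERIV_mult[OF DERIV_fun_powr[OF DERIV_line_one_minus_norm_square pos] q]])
    show "b * (1 - (norm (y + 0 *\<^sub>R axis i (1::real)))\<^sup>2) powr (b - real 1) * (- 2 * (y + 0 *\<^sub>R axis i 1) $ i) * q (y + 0 *\<^sub>R axis i 1)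
      + q' (y + 0 *\<^sub>R axis i 1) * (1 - (norm (y + 0 *\<^sub>R axis i (1::real)))\<^sup>2) powr b
      = (1 - (norm y)\<^sup>2) powr (b - 1) * (- 2 * b * (y $ i * q y) + (1 - (norm y)\<^sup>2) * q' y)"
      by (simp, unfold eq) (simp add: algebra_simps)
  qed
qed

text \<open>Up to normalization \<open>q\<close> is the Rodrigues-type orthogonal polynomial of the
  ball. The moment identity belongs to the same existential statement because \<open>q\<close> has
  no closed form, and it is claimed for all \<open>j\<close> because each induction step appeals to
  it with \<open>j i\<close> lowered by one. The coefficient
  \<open>fact (count_list ds l) * real (j l choose count_list ds l)\<close> is the falling factorial
  produced by differentiating a power; it is 0 where the truncated subtraction in the exponent would
  be wrong. The bound on \<open>length ds\<close> keeps every exponent positive before a derivative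
  is taken and leaves the last one above -1.\<close>

lemma iterated_partial_ball_powr:
  fixes a :: real and ds :: "'n::finite list"
  assumes "real (length ds) < a + 1"
  shows "\<exists>q :: real ^ 'n \<Rightarrow> real. real_polynomial_function q
    \<and> (\<forall>y. norm y < 1 \<longrightarrow> foldr partial_deriv ds (\<lambda>y. (1 - (norm y)\<^sup>2) powr a) y
          = (1 - (norm y)\<^sup>2) powr (a - length ds) * q y)
    \<and> (\<forall>j. ball_integral (a - length ds) (\<lambda>y. q y * mi_power y j)
          = (-1) ^ length ds * (\<Prod>l\<in>UNIV. fact (count_list ds l) * real (j l choose count_list ds l))
            * ball_integral a (\<lambda>y. mi_power y (\<lambda>l. j l - count_list ds l)))"
  using assms
proof (induction ds)
  case Nil
  show ?case by (intro exI[of _ "\<lambda>_. 1"]) (auto intro: real_polynomial_function.intros(2))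
next
  case (Cons i ds)
  define b where "b = a - length ds"
  have b: "b > 0" using Cons.prems by (simp add: b_def)
  obtain q :: "real ^ 'n \<Rightarrow> real" where q: "real_polynomial_function q"
    "\<And>y. norm y < 1 \<Longrightarrow> foldr partial_deriv ds (\<lambda>y. (1 - (norm y)\<^sup>2) powr a) y = (1 - (norm y)\<^sup>2) powr b * q y"
    "\<And>j. ball_integral b (\<lambda>y. q y * mi_power y j)
          = (-1) ^ length ds * (\<Prod>l\<in>UNIV. fact (count_list ds l) * real (j l choose count_list ds l))
            * ball_integral a (\<lambda>y. mi_power y (\<lambda>l. j l - count_list ds l))"
    using Cons unfolding b_def by auto
  obtain q' where q': "real_polynomial_function q'"
    "\<And>y s. ((\<lambda>s. q (y + s *\<^sub>R axis i 1)) has_real_derivative q' (y + s *\<^sub>R axis i 1)) (at s)"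
    using real_polynomial_function_directional_derivative[OF q(1), of "axis i 1"] by blast
  define r where "r y = - 2 * b * (y $ i * q y) + (1 - (norm y)\<^sup>2) * q' y" for y :: "real ^ 'n"
  have r: "real_polynomial_function r"
    unfolding r_def using q(1) q'(1)
    by (intro real_polynomial_function.intros(3) real_polynomial_function.intros(4) real_polynomial_function_diff
        real_polynomial_function.intros(2) real_polynomial_function_nth real_polynomial_function_norm_square)
  have "partial_deriv i (foldr partial_deriv ds (\<lambda>y. (1 - (norm y)\<^sup>2) powr a)) y
      = (1 - (norm y)\<^sup>2) powr (b - 1) * r y" if "norm y < 1" for y
    by (rule partial_deriv_eqI[of "ball 0 1", OF open_ball _ _
         DERIV_ball_powr_poly[OF that q'(2), of b, folded r_def]]) (use that q(2) in auto)
  moreover have "ball_integral (b - 1) (\<lambda>y. r y * mi_power y j)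
      = (-1) ^ Suc (length ds)
        * (\<Prod>l\<in>UNIV. fact (count_list (i # ds) l) * real (j l choose count_list (i # ds) l))
        * ball_integral a (\<lambda>y. mi_power y (\<lambda>l. j l - count_list (i # ds) l))" for j
  proof -
    note pf = real_polynomial_function_continuous_on real_polynomial_function.intros(3) real_polynomial_function.intros(4)
      real_polynomial_function_diff real_polynomial_function.intros(2) real_polynomial_function_nth
      real_polynomial_function_norm_square real_polynomial_function_mi_power q(1) q'(1)
    let ?j = "j(i := j i - 1)"
    have "ball_integral (b - 1) (\<lambda>y. r y * mi_power y j)
       = ball_integral (b - 1) (\<lambda>y. (- 2 * b) * (y $ i * (q y * mi_power y j)) + (1 - (norm y)\<^sup>2) * (q' y * mi_power y j))"
      by (simp add: r_def algebra_simps)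
    also have "\<dots> = ball_integral (b - 1) (\<lambda>y. (- 2 * b) * (y $ i * (q y * mi_power y j)))
          + ball_integral (b - 1) (\<lambda>y. (1 - (norm y)\<^sup>2) * (q' y * mi_power y j))"
      by (rule ball_integral_add) (use b in \<open>auto intro!: pf\<close>)
    also have "\<dots> = - (2 * b * ball_integral (b - 1) (\<lambda>y. y $ i * (q y * mi_power y j)))
          + ball_integral b (\<lambda>y. q' y * mi_power y j)"
      unfolding ball_integral_cmult ball_integral_one_minus_norm_square by simp
    \<comment> \<open>Integration by parts is applied to the whole product
      \<open>q y * mi_power y j\<close>. The part of its derivative containing \<open>q'\<close>
      cancels the \<open>q'\<close> term of \<open>r\<close>, and only the derivative of the
      monomial survives.\<close>
    also have "2 * b * ball_integral (b - 1) (\<lambda>y. y $ i * (q y * mi_power y j))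
        = ball_integral b (\<lambda>y. q' y * mi_power y j + real (j i) * mi_power y ?j * q y)"
      by (rule ball_integral_by_parts[OF b _ _ DERIV_mult[OF q'(2) DERIV_mi_power_line]]) (auto intro!: pf)
    also have "\<dots> = ball_integral b (\<lambda>y. q' y * mi_power y j) + ball_integral b (\<lambda>y. real (j i) * (q y * mi_power y ?j))"
      by (subst ball_integral_add[symmetric]) (use b in \<open>auto intro!: pf simp: mult_ac\<close>)
    finally have "ball_integral (b - 1) (\<lambda>y. r y * mi_power y j) = - real (j i) * ball_integral b (\<lambda>y. q y * mi_power y ?j)"
      by (simp add: ball_integral_cmult)
    also have "\<dots> = (-1) ^ Suc (length ds)
        * (real (j i) * (\<Prod>l\<in>UNIV. fact (count_list ds l) * real (?j l choose count_list ds l)))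
        * ball_integral a (\<lambda>y. mi_power y (\<lambda>l. ?j l - count_list ds l))"
      unfolding q(3) by simp
    also have "(\<lambda>l. ?j l - count_list ds l) = (\<lambda>l. j l - count_list (i # ds) l)"
      by (auto simp: fun_eq_iff)
    also have "real (j i) * (\<Prod>l\<in>UNIV. fact (count_list ds l) * real (?j l choose count_list ds l))
       = (\<Prod>l\<in>UNIV. fact (count_list (i # ds) l) * real (j l choose count_list (i # ds) l))"
    proof -
      let ?c = "count_list ds i"
      \<comment> \<open>Falling factorials: extracting the factor \<open>j i\<close> from that of
        order \<open>Suc ?c\<close> leaves the one of order \<open>?c\<close> at
        \<open>j i - 1\<close>. For \<open>j i = 0\<close> both sides are 0.\<close>
      have "real (j i) * (fact ?c * real ((j i - 1) choose ?c)) = fact (Suc ?c) * real (j i choose Suc ?c)"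
      proof (cases "j i")
        case (Suc m)
        have "Suc ?c * (Suc m choose Suc ?c) = Suc m * (m choose ?c)" by (rule Suc_times_binomial)
        then have "real (Suc ?c) * real (Suc m choose Suc ?c) = real (Suc m) * real (m choose ?c)"
          unfolding of_nat_mult[symmetric] by (simp only:)
        then have "real (Suc m) * (fact ?c * real (m choose ?c)) = fact ?c * (real (Suc ?c) * real (Suc m choose Suc ?c))"
          by (simp only: mult_ac)
        then show ?thesis unfolding Suc fact_Suc by (simp only: mult_ac diff_Suc_1)
      qed simp
      then show ?thesis
        by (subst (1 2) prod.remove[of _ i]) (auto simp: mult.assoc[symmetric] intro!: prod.cong)
    qed
    finally show ?thesis .
  qed
  ultimately show ?case
    using r by (intro exI[of _ r]) (auto simp: b_def algebra_simps)
qed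

text \<open>Homogeneity: the undifferentiated function scales by \<open>t powr (2 * a)\<close>, and
  the chain rule costs a factor \<open>1 / t\<close> per derivative. As \<open>partial_deriv\<close>
  is only a \<open>deriv\<close>, the chain rule needs genuine differentiability of the inner
  iterate, which the polynomial form from the unit ball provides.\<close>

lemma iterated_partial_scaling:
  fixes a t :: real and ds :: "'n::finite list"
  assumes "t > 0" "real (length ds) < a + 1" "norm (x :: real ^ 'n) < t"
  shows "foldr partial_deriv ds (\<lambda>y. (t\<^sup>2 - (norm y)\<^sup>2) powr a) x
     = t powr (2 * a - length ds) * foldr partial_deriv ds (\<lambda>y. (1 - (norm y)\<^sup>2) powr a) (x /\<^sub>R t)"
  using assms
proof (induction ds arbitrary: x)
  case Nil
  have "t\<^sup>2 - (norm x)\<^sup>2 = t\<^sup>2 * (1 - (norm (x /\<^sub>R t))\<^sup>2)"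
    using Nil by (simp add: field_simps power_divide)
  moreover have "1 - (norm (x /\<^sub>R t))\<^sup>2 > 0"
    using Nil by (simp add: abs_square_less_1 divide_simps power_strict_mono)
  ultimately show ?case
    using Nil by (simp add: powr_mult powr_powr flip: powr_numeral)
next
  case (Cons i ds)
  let ?P = "foldr partial_deriv ds (\<lambda>y. (1 - (norm y)\<^sup>2) powr a)"
  let ?b = "a - length ds"
  obtain q :: "real ^ 'n \<Rightarrow> real" where q: "real_polynomial_function q"
    "\<And>y. norm y < 1 \<Longrightarrow> ?P y = (1 - (norm y)\<^sup>2) powr ?b * q y"
    using iterated_partial_ball_powr[of ds a] Cons.prems by auto
  obtain q' where q': "real_polynomial_function q'"
    "\<And>y s. ((\<lambda>s. q (y + s *\<^sub>R axis i 1)) has_real_derivative q' (y + s *\<^sub>R axis i 1)) (at s)"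
    using real_polynomial_function_directional_derivative[OF q(1), of "axis i 1"] by blast
  have x: "norm (x /\<^sub>R t) < 1" using Cons.prems by (simp add: divide_simps)
  let ?D = "(1 - (norm (x /\<^sub>R t))\<^sup>2) powr (?b - 1) * (- 2 * ?b * ((x /\<^sub>R t) $ i * q (x /\<^sub>R t)) + (1 - (norm (x /\<^sub>R t))\<^sup>2) * q' (x /\<^sub>R t))"
  note D = DERIV_ball_powr_poly[OF x q'(2), of ?b]
  have PD: "partial_deriv i ?P (x /\<^sub>R t) = ?D"
    by (rule partial_deriv_eqI[of "ball 0 1", OF open_ball _ _ D]) (use x q(2) in auto)
  let ?G = "\<lambda>x. t powr (2 * a - length ds) * ((1 - (norm (x /\<^sub>R t))\<^sup>2) powr ?b * q (x /\<^sub>R t))"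
  have "((\<lambda>s. ?G (x + s *\<^sub>R axis i 1)) has_real_derivative t powr (2 * a - length ds) * (?D * (1 / t))) (at 0)"
  proof (rule DERIV_cmult)
    \<comment> \<open>Moving \<open>x\<close> by \<open>s\<close> along the axis moves
      \<open>x /\<^sub>R t\<close> by \<open>s / t\<close>, so \<open>?H\<close> is composed with
      division by \<open>t\<close>.\<close>
    let ?H = "\<lambda>s. (1 - (norm (x /\<^sub>R t + s *\<^sub>R axis i 1))\<^sup>2) powr ?b * q (x /\<^sub>R t + s *\<^sub>R axis i 1)"
    have "((\<lambda>s. s / t) has_real_derivative 1 / t) (at 0)"
      using Cons.prems(1) by (auto intro!: derivative_eq_intros)
    moreover have "(?H has_real_derivative ?D) (at (0 / t))"
      using D by (simp only: div_0)
    ultimately have "((\<lambda>s. ?H (s / t)) has_real_derivative ?D * (1 / t)) (at 0)"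
      by (rule DERIV_chain2[where f = ?H and g = "\<lambda>s. s / t", rotated])
    then show "((\<lambda>s. (1 - (norm ((x + s *\<^sub>R axis i 1) /\<^sub>R t))\<^sup>2) powr ?b * q ((x + s *\<^sub>R axis i 1) /\<^sub>R t))
       has_real_derivative ?D * (1 / t)) (at 0)"
      by (simp add: scaleR_add_right divide_inverse mult.commute)
  qed
  then have "partial_deriv i (foldr partial_deriv ds (\<lambda>y. (t\<^sup>2 - (norm y)\<^sup>2) powr a)) x
      = t powr (2 * a - length ds) * (?D * (1 / t))"
  proof (rule partial_deriv_eqI[of "ball 0 t", rotated 3])
    fix y :: "real ^ 'n" assume "y \<in> ball 0 t"
    then have "norm y < t" "norm (y /\<^sub>R t) < 1" using Cons.prems(1) by (simp_all add: divide_simps)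
    then show "foldr partial_deriv ds (\<lambda>y. (t\<^sup>2 - (norm y)\<^sup>2) powr a) y = ?G y"
      using Cons.IH[of y] q(2) Cons.prems by simp
  qed (use Cons.prems in auto)
  also have "\<dots> = t powr (2 * a - length ds - 1) * ?D"
    using Cons.prems by (simp add: powr_diff)
  finally show ?case
    by (simp add: PD algebra_simps)
qed

text \<open>The results above hold for an arbitrary direction list, and their final formulas involve
  only its length and its counts, so the choice hidden in \<open>mi_deriv\<close> can be forgotten
  here.\<close>

lemma mi_deriv_direction_list:
  obtains ds where "\<And>i. count_list ds i = k i" "length ds = mi_deg k"
    "\<And>f. mi_deriv k f = foldr partial_deriv ds f"
proof -
  define ds where "ds = (SOME ds. \<forall>i. count_list ds i = k i)"
  have "\<forall>i. count_list ds i = k i"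
    unfolding ds_def by (rule someI_ex[OF ex_direction_list])
  moreover from this have "length ds = mi_deg k"
    using sum_count_set[of ds UNIV] by (simp add: mi_deg_def)
  ultimately show ?thesis
    by (intro that[of ds]) (auto simp: mi_deriv_def ds_def)
qed

section \<open>Jacobi weights and cone coordinates\<close>

lemma borel_measurable_poly [measurable]: "poly p \<in> borel_measurable (borel :: real measure)"
  by (intro borel_measurable_continuous_onI continuous_intros)

lemma integrable_Jacobi_weight_poly:
  fixes b c :: real
  assumes "b > -1" "c > -1"
  shows "integrable lborel (\<lambda>t. indicator {0<..<1} t * (t powr b * (1 - t) powr c * poly p t))"
proof -
  have "compact (poly p ` {0..1})"
    by (intro compact_continuous_image continuous_intros) auto
  then obtain M where M: "\<And>t. t \<in> {0..1} \<Longrightarrow> \<bar>poly p t\<bar> \<le> M"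
    by (metis bounded_iff compact_imp_bounded imageI real_norm_def)
  have "set_integrable lborel {0..1} (\<lambda>t::real. t powr ((b + 1) - 1) * (1 - t) powr ((c+1) - 1))"
    by (rule integrable_Beta) (use assms in auto)
  then have "integrable lborel (\<lambda>t. M * (indicator {0..1} t * (t powr b * (1 - t) powr c)))"
    by (simp add: set_integrable_def)
  then show ?thesis
  proof (rule Bochner_Integration.integrable_bound)
    show "AE t in lborel. norm (indicator {0<..<1} t * (t powr b * (1 - t) powr c * poly p t))
      \<le> norm (M * (indicator {0..1} t * (t powr b * (1 - t) powr c)))"
    proof (rule AE_I2)
      fix t :: real
      show "norm (indicator {0<..<1} t * (t powr b * (1 - t) powr c * poly p t))
        \<le> norm (M * (indicator {0..1} t * (t powr b * (1 - t) powr c)))"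
      proof (cases "t \<in> {0<..<1}")
        case True
        then have "t powr b * (1 - t) powr c * \<bar>poly p t\<bar> \<le> t powr b * (1 - t) powr c * \<bar>M\<bar>"
          using M[of t] by (intro mult_left_mono) auto
        then show ?thesis using True by (simp add: abs_mult mult_ac)
      qed simp
    qed
  qed measurable
qed

lemma integral_Jacobi_weight:
  fixes b c :: real
  assumes "b > -1" "c > -1"
  shows "(\<integral>t. indicator {0<..<1} t * (t powr b * (1 - t) powr c) \<partial>lborel) = Beta (b + 1) (c + 1)"
proof -
  have "set_integrable lborel {0<..<1} (\<lambda>t. t powr b * (1 - t) powr c)"
    using integrable_Jacobi_weight_poly[OF assms, of 1] by (simp add: set_integrable_def)
  from set_borel_integral_eq_integral(2)[OF this]
  have "(\<integral>t. indicator {0<..<1} t * (t powr b * (1 - t) powr c) \<partial>lborel)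
      = integral {0<..<1} (\<lambda>t. t powr b * (1 - t) powr c)"
    by (simp add: set_lebesgue_integral_def)
  also have "\<dots> = Beta (b + 1) (c + 1)"
    using has_integral_Beta_real[of "b + 1" "c + 1"] assms
    by (intro integral_unique) (simp add: has_integral_Icc_iff_Ioo)
  finally show ?thesis .
qed

text \<open>Lowering both exponents by one leaves \<open>t * (1 - t)\<close>, encoded as
  \<open>[:0, 1, -1:]\<close>, in front of \<open>pderiv p\<close>, while each differentiated power
  leaves the other linear factor.\<close>

lemma DERIV_Jacobi_weight_poly:
  fixes b c t :: real
  assumes "0 < t" "t < 1"
  shows "((\<lambda>t. t powr b * (1 - t) powr c * poly p t) has_real_derivative
     t powr (b - 1) * (1 - t) powr (c - 1) *
       poly (pderiv p * [:0, 1, -1:] + smult b ([:1, -1:] * p) - smult c ([:0, 1:] * p)) t) (at t)"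
proof -
  have e: "t powr b = t powr (b - 1) * t" "(1 - t) powr c = (1 - t) powr (c - 1) * (1 - t)"
    using assms by (simp_all add: powr_diff)
  have "((\<lambda>t. t powr b) has_real_derivative b * t powr (b - 1)) (at t)"
    "((\<lambda>t. (1 - t) powr c) has_real_derivative - c * (1 - t) powr (c - 1)) (at t)"
    using assms by (auto intro!: derivative_eq_intros)
  from DERIV_mult[OF DERIV_mult[OF this] poly_DERIV[of p]] show ?thesis
    by (rule DERIV_cong, unfold e) (simp add: algebra_simps)
qed

text \<open>The Rodrigues formula for Jacobi polynomials on the unit interval. The polynomial stays
  anonymous; integrability and boundary values depend only on the two exponents.\<close>

lemma iterated_deriv_Jacobi_weight:
  fixes b c :: real
  shows "\<exists>p. \<forall>t. 0 < t \<and> t < 1 \<longrightarrow> (deriv ^^ l) (\<lambda>s. s powr b * (1 - s) powr c) t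
    = t powr (b - real l) * (1 - t) powr (c - real l) * poly p t"
proof (induction l)
  case 0
  show ?case by (intro exI[of _ 1]) simp
next
  case (Suc l)
  then obtain p where p: "\<And>t. 0 < t \<Longrightarrow> t < 1 \<Longrightarrow> (deriv ^^ l) (\<lambda>s. s powr b * (1 - s) powr c) t
    = t powr (b - real l) * (1 - t) powr (c - real l) * poly p t" by blast
  have "(deriv ^^ Suc l) (\<lambda>s. s powr b * (1 - s) powr c) t = t powr (b - real (Suc l)) * (1 - t) powr (c - real (Suc l)) *
       poly (pderiv p * [:0, 1, -1:] + smult (b - l) ([:1, -1:] * p) - smult (c - l) ([:0, 1:] * p)) t"
    if t: "0 < t" "t < 1" for t
  proof -
    have "((deriv ^^ l) (\<lambda>s. s powr b * (1 - s) powr c) has_real_derivative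
       t powr (b - l - 1) * (1 - t) powr (c - l - 1) *
       poly (pderiv p * [:0, 1, -1:] + smult (b - l) ([:1, -1:] * p) - smult (c - l) ([:0, 1:] * p)) t) (at t)"
      by (rule has_field_derivative_transform_within_open[OF DERIV_Jacobi_weight_poly[OF t], of "{0<..<1}"])
         (use t p in auto)
    then show ?thesis by (simp add: DERIV_imp_deriv algebra_simps)
  qed
  then show ?case by blast
qed

text \<open>Each integration by parts lowers \<open>m\<close> and \<open>l\<close> together. For
  \<open>m < l\<close> the power of \<open>t\<close> is exhausted first and its derivative is 0; for
  \<open>m = l\<close> the process ends in a Beta integral after collecting a sign and a factor
  \<open>m\<close> at every step.\<close>

lemma integral_power_iterated_deriv_Jacobi_weight:
  fixes b c :: real
  assumes "b - real l > -1" "c - real l > -1" "m \<le> l"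
  shows "(\<integral>t. indicator {0<..<1} t * (t ^ m * (deriv ^^ l) (\<lambda>s. s powr b * (1 - s) powr c) t) \<partial>lborel)
    = (if m = l then (-1) ^ l * fact l * Beta (b + 1) (c + 1) else 0)"
  using assms
proof (induction l arbitrary: m)
  case 0
  then show ?case using integral_Jacobi_weight[of b c] by simp
next
  case (Suc l)
  define D where "D l = (deriv ^^ l) (\<lambda>s. s powr b * (1 - s) powr c)" for l
  have D_int: "integrable lborel (\<lambda>t. indicator {0<..<1} t * (t ^ m * D l' t))"
    if "b - real l' > -1" "c - real l' > -1" for m l'
  proof -
    obtain p where p: "\<And>t. 0 < t \<Longrightarrow> t < 1 \<Longrightarrow> D l' t = t powr (b - l') * (1 - t) powr (c - l') * poly p t"
      unfolding D_def using iterated_deriv_Jacobi_weight by blast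
    have "(\<lambda>t. indicator {0<..<1} t * (t ^ m * D l' t))
       = (\<lambda>t. indicator {0<..<1} t * (t powr (b - l') * (1 - t) powr (c - l') * poly (monom 1 m * p) t))"
      by (auto simp: fun_eq_iff indicator_def p poly_monom)
    then show ?thesis using integrable_Jacobi_weight_poly[OF that, of "monom 1 m * p"] by simp
  qed
  obtain p where p: "\<And>t. 0 < t \<Longrightarrow> t < 1 \<Longrightarrow> D l t = t powr (b - l) * (1 - t) powr (c - l) * poly p t"
    unfolding D_def using iterated_deriv_Jacobi_weight by blast
  have bl: "b - l > 0" "c - l > 0" using Suc.prems by auto
  \<comment> \<open>The iterated \<open>deriv\<close> is controlled only on the open interval.
    \<open>F\<close> replaces it by the Rodrigues form, which is continuous on the closed interval
    and vanishes at both ends because \<open>b - l\<close> and \<open>c - l\<close> are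
    positive.\<close>
  define F where "F t = t ^ m * (t powr (b - l) * (1 - t) powr (c - l) * poly p t)" for t
  define G where "G t = real m * (t ^ (m - 1) * D l t) + t ^ m * D (Suc l) t" for t
  have G: "(F has_real_derivative G t) (at t)" if t: "0 < t" "t < 1" for t
  proof -
    have D: "(D l has_real_derivative D (Suc l) t) (at t)"
    proof -
      have "(D l has_real_derivative
         t powr (b - l - 1) * (1 - t) powr (c - l - 1) *
         poly (pderiv p * [:0, 1, -1:] + smult (b - l) ([:1, -1:] * p) - smult (c - l) ([:0, 1:] * p)) t) (at t)"
        by (rule has_field_derivative_transform_within_open[OF DERIV_Jacobi_weight_poly[OF t], of "{0<..<1}"])
           (use t p in auto)
      then show ?thesis
        by (simp only: DERIV_imp_deriv D_def funpow.simps o_def)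
    qed
    have "((\<lambda>t. t ^ m * D l t) has_real_derivative G t) (at t)"
      using D by (auto intro!: derivative_eq_intros simp: G_def)
    then show ?thesis
      by (rule has_field_derivative_transform_within_open[of _ _ _ "{0<..<1}"]) (use t p in \<open>auto simp: F_def\<close>)
  qed
  have i1: "integrable lborel (\<lambda>t. indicator {0<..<1} t * (t ^ (m - 1) * D l t))"
    using bl by (intro D_int) auto
  have i2: "integrable lborel (\<lambda>t. indicator {0<..<1} t * (t ^ m * D (Suc l) t))"
    using Suc.prems by (intro D_int) auto
  have "(G has_integral F 1 - F 0) {0..1}"
  proof (rule fundamental_theorem_of_calculus_interior)
    show "continuous_on {0..1} F"
      unfolding F_def using bl by (intro continuous_intros continuous_on_powr') auto
  qed (use G in \<open>auto simp: has_real_derivative_iff_has_vector_derivative\<close>)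
  then have "integral {0<..<1} G = 0"
    using bl by (simp add: has_integral_Icc_iff_Ioo F_def integral_unique)
  moreover have iG: "integrable lborel (\<lambda>t. indicator {0<..<1} t * G t)"
  proof -
    have "(\<lambda>t. indicator {0<..<1} t * G t)
      = (\<lambda>t. real m * (indicator {0<..<1} t * (t ^ (m - 1) * D l t)) + indicator {0<..<1} t * (t ^ m * D (Suc l) t))"
      by (simp add: G_def algebra_simps)
    then show ?thesis using i1 i2 by simp
  qed
  ultimately have "(\<integral>t. indicator {0<..<1} t * G t \<partial>lborel) = 0"
    using set_borel_integral_eq_integral(2)[of "{0<..<1}" G]
    by (simp add: set_integrable_def set_lebesgue_integral_def)
  also have "(\<integral>t. indicator {0<..<1} t * G t \<partial>lborel)
    = (\<integral>t. real m * (indicator {0<..<1} t * (t ^ (m - 1) * D l t)) + indicator {0<..<1} t * (t ^ m * D (Suc l) t) \<partial>lborel)"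
    by (simp add: G_def algebra_simps)
  also have "\<dots> = real m * (\<integral>t. indicator {0<..<1} t * (t ^ (m - 1) * D l t) \<partial>lborel)
     + (\<integral>t. indicator {0<..<1} t * (t ^ m * D (Suc l) t) \<partial>lborel)"
    using i1 i2 by simp
  finally have "(\<integral>t. indicator {0<..<1} t * (t ^ m * D (Suc l) t) \<partial>lborel)
     = - real m * (\<integral>t. indicator {0<..<1} t * (t ^ (m - 1) * D l t) \<partial>lborel)" by simp
  also have "\<dots> = (if m = Suc l then (-1) ^ Suc l * fact (Suc l) * Beta (b + 1) (c + 1) else 0)"
  proof (cases m)
    case (Suc m')
    then show ?thesis
      using Suc.IH[of m'] Suc.prems bl by (auto simp: D_def algebra_simps)
  qed simp
  finally show ?case unfolding D_def .
qed

section \<open>Dilation coordinates on the cone\<close>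

lemma integral_lborel_scaleR:
  fixes g :: "'a::euclidean_space \<Rightarrow> real"
  assumes g: "integrable lborel g" and t: "t > 0"
  shows "integrable lborel (\<lambda>x. g (x /\<^sub>R t))"
    and "(\<integral>x. g (x /\<^sub>R t) \<partial>lborel) = t ^ DIM('a) * integral\<^sup>L lborel g"
proof -
  have [measurable]: "g \<in> borel_measurable borel" using g by auto
  have l: "lborel = density (distr lborel borel (\<lambda>x::'a. t *\<^sub>R x)) (\<lambda>_. ennreal (t ^ DIM('a)))"
    using lborel_affine[of t "0::'a"] t by simp
  have "integrable (distr lborel borel (\<lambda>x::'a. t *\<^sub>R x)) (\<lambda>x. g (x /\<^sub>R t))"
    using g t by (subst integrable_distr_eq) auto
  then show "integrable lborel (\<lambda>x. g (x /\<^sub>R t))"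
    by (subst l, subst integrable_density) (use t in auto)
  have "(\<integral>x. g (x /\<^sub>R t) \<partial>lborel) = (\<integral>x. t ^ DIM('a) * g (x /\<^sub>R t) \<partial>(distr lborel borel (\<lambda>x::'a. t *\<^sub>R x)))"
    by (subst l, subst integral_density) (use t in auto)
  also have "\<dots> = t ^ DIM('a) * integral\<^sup>L lborel g"
    using t by (subst integral_distr) auto
  finally show "(\<integral>x. g (x /\<^sub>R t) \<partial>lborel) = t ^ DIM('a) * integral\<^sup>L lborel g" .
qed

text \<open>For fixed \<open>t > 0\<close> the dilation of the slice has Jacobian
  \<open>t ^ DIM('a)\<close>, cancelled by the denominator, so the slice integral is a constant
  times \<open>h t\<close>. The vanishing of \<open>h\<close> on nonpositive \<open>t\<close>
  removes the slices where the dilation is meaningless.\<close>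

lemma cone_integral_product:
  fixes g :: "'a::euclidean_space \<Rightarrow> real" and h :: "real \<Rightarrow> real"
  assumes g: "integrable lborel g" and h: "integrable lborel h" and h0: "\<And>t. t \<le> 0 \<Longrightarrow> h t = 0"
  shows "integrable lborel (\<lambda>(x, t). g (x /\<^sub>R t) * (h t / t ^ DIM('a)))"
    and "(\<integral>(x, t). g (x /\<^sub>R t) * (h t / t ^ DIM('a)) \<partial>lborel) = integral\<^sup>L lborel g * integral\<^sup>L lborel h"
proof -
  have [measurable]: "g \<in> borel_measurable borel" "h \<in> borel_measurable borel" using g h by auto
  define F where "F = (\<lambda>(x, t). g (x /\<^sub>R t) * (h t / t ^ DIM('a)))"
  have Fm[measurable]: "F \<in> borel_measurable (lborel \<Otimes>\<^sub>M lborel)" unfolding F_def by measurable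
  have int: "(\<integral>x. G (x /\<^sub>R t) * (H t / t ^ DIM('a)) \<partial>lborel) = integral\<^sup>L lborel G * H t"
    if "integrable lborel G" "\<And>t. t \<le> 0 \<Longrightarrow> H t = 0" for G :: "'a \<Rightarrow> real" and H :: "real \<Rightarrow> real" and t
  proof (cases "t > 0")
    case True
    then show ?thesis using integral_lborel_scaleR[OF that(1) True] by simp
  qed (use that(2) in auto)
  \<comment> \<open>Only slices in \<open>x\<close> at fixed \<open>t\<close> are computable,
    whereas pairs are ordered as \<open>(x, t)\<close>; Fubini is therefore applied to the swapped
    product.\<close>
  have "integrable (lborel \<Otimes>\<^sub>M lborel) (\<lambda>(t, x). F (x, t))"
  proof (rule lborel_pair.Fubini_integrable)
    have "(\<integral>x. norm (F (x, t)) \<partial>lborel) = (\<integral>y. \<bar>g y\<bar> \<partial>lborel) * \<bar>h t\<bar>" for t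
    proof -
      have "norm (F (x, t)) = \<bar>g (x /\<^sub>R t)\<bar> * (\<bar>h t\<bar> / t ^ DIM('a))" for x
        using h0[of t] by (cases "t \<le> 0") (auto simp: F_def abs_mult)
      then show ?thesis using int[OF integrable_abs[OF g], of "\<lambda>t. \<bar>h t\<bar>" t] h0 by simp
    qed
    then show "integrable lborel (\<lambda>t. \<integral>x. norm (case (t, x) of (t, x) \<Rightarrow> F (x, t)) \<partial>lborel)"
      using h by simp
    show "AE t in lborel. integrable lborel (\<lambda>x. case (t, x) of (t, x) \<Rightarrow> F (x, t))"
    proof (rule AE_I2)
      fix t
      show "integrable lborel (\<lambda>x. case (t, x) of (t, x) \<Rightarrow> F (x, t))"
        using h0[of t] integral_lborel_scaleR(1)[OF g, of t] by (cases "t > 0") (auto simp: F_def)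
    qed
  qed measurable
  then have Fi: "integrable (lborel \<Otimes>\<^sub>M lborel) F"
    using lborel_pair.integrable_product_swap_iff[of F] by simp
  then show "integrable lborel (\<lambda>(x, t). g (x /\<^sub>R t) * (h t / t ^ DIM('a)))"
    unfolding F_def lborel_prod .
  have "(\<integral>t. (\<integral>x. F (x, t) \<partial>lborel) \<partial>lborel) = integral\<^sup>L (lborel \<Otimes>\<^sub>M lborel) F"
    using lborel_pair.integral_snd[of "\<lambda>x t. F (x, t)"] Fi by simp
  moreover have "(\<integral>x. F (x, t) \<partial>lborel) = integral\<^sup>L lborel g * h t" for t
    using int[OF g h0] by (simp add: F_def)
  ultimately show "(\<integral>(x, t). g (x /\<^sub>R t) * (h t / t ^ DIM('a)) \<partial>lborel) = integral\<^sup>L lborel g * integral\<^sup>L lborel h"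
    unfolding F_def lborel_prod by simp
qed

section \<open>Monomial orthogonal polynomials on the cone\<close>

lemma closed_VV: "closed (VV :: ((real ^ 'n::finite) \<times> real) set)"
proof -
  have "VV = {p :: (real ^ 'n) \<times> real. norm (fst p) \<le> snd p} \<inter> {p. 0 \<le> snd p} \<inter> {p. snd p \<le> 1}"
    by (auto simp: VV_def)
  also have "closed \<dots>"
    by (intro closed_Int closed_Collect_le continuous_intros)
  finally show ?thesis .
qed

lemma VV_measurable [measurable]: "(VV :: ((real ^ 'n::finite) \<times> real) set) \<in> sets borel"
  using closed_VV by (rule borel_closed)

lemma compact_VV: "compact (VV :: ((real ^ 'n::finite) \<times> real) set)"
proof -
  have "VV \<subseteq> cball (0 :: real ^ 'n) 1 \<times> {0..1::real}"
    by (auto simp: VV_def)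
  moreover have "compact (cball (0 :: real ^ 'n) 1 \<times> {0..1::real})"
    by (intro compact_Times) auto
  ultimately show ?thesis
    using closed_VV by (metis compact_Int_closed inf.absorb_iff2)
qed

lemma weight_measurable [measurable]:
  "(weight \<beta> \<gamma> \<mu> :: (real ^ 'n::finite) \<times> real \<Rightarrow> real) \<in> borel_measurable borel"
proof -
  have "weight \<beta> \<gamma> \<mu> = (\<lambda>p :: (real ^ 'n) \<times> real.
     ((snd p)\<^sup>2 - (norm (fst p))\<^sup>2) powr (\<mu> - 1/2) * snd p powr \<beta> * (1 - snd p) powr \<gamma>)"
    by (auto simp: weight_def fun_eq_iff)
  moreover have [measurable]: "(fst :: (real ^ 'n) \<times> real \<Rightarrow> _) \<in> borel_measurable borel"
    "(snd :: (real ^ 'n) \<times> real \<Rightarrow> _) \<in> borel_measurable borel"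
    by (auto intro!: borel_measurable_continuous_onI continuous_intros)
  ultimately show ?thesis by simp
qed

lemma weight_nonneg: "p \<in> VV \<Longrightarrow> weight \<beta> \<gamma> \<mu> p \<ge> 0"
  by (auto simp: weight_def split: prod.splits)

text \<open>Since \<open>0 powr a = 0\<close> for every \<open>a\<close>, identities between integrands hold on all of \<open>VV\<close>,
  not only almost everywhere.\<close>

lemma weight_eq_0_boundary:
  assumes "(x, t) \<in> VV" "\<not> (norm x < t \<and> t < 1)"
  shows "weight \<beta> \<gamma> \<mu> (x, t) = 0"
  using assms by (auto simp: weight_def VV_def not_less)

lemma weight_polar:
  assumes "0 < t" "norm x < t"
  shows "(t\<^sup>2 - (norm (x :: 'a::real_normed_vector))\<^sup>2) powr a = t powr (2 * a) * (1 - (norm (x /\<^sub>R t))\<^sup>2) powr a"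
proof -
  have "t\<^sup>2 - (norm x)\<^sup>2 = t\<^sup>2 * (1 - (norm (x /\<^sub>R t))\<^sup>2)"
    using assms by (simp add: field_simps power_divide)
  moreover have "1 - (norm (x /\<^sub>R t))\<^sup>2 > 0"
    using assms by (simp add: abs_square_less_1 divide_simps power_strict_mono)
  ultimately show ?thesis
    using assms by (simp add: powr_mult powr_powr flip: powr_numeral)
qed

text \<open>The dilated weight contributes \<open>t powr (2 * (\<mu> - 1/2))\<close> and the
  Jacobian \<open>t ^ CARD('n)\<close>; together with \<open>t powr \<beta>\<close> this is a Jacobi
  weight in \<open>t\<close>, integrable at 0 exactly because
  \<open>2 * \<mu> + \<beta> + real CARD('n) > 0\<close>.\<close>

lemma
  fixes \<mu> \<beta> \<gamma> :: real
  assumes "\<mu> > - 1/2" "\<gamma> > - 1" "2 * \<mu> + \<beta> + real CARD('n) > 0"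
  shows weight_integrable: "integrable lborel (\<lambda>p :: (real ^ 'n::finite) \<times> real. indicator VV p * weight \<beta> \<gamma> \<mu> p)"
    and weight_integral: "(LINT p:(VV :: ((real ^ 'n::finite) \<times> real) set)|lborel. weight \<beta> \<gamma> \<mu> p)
      = ball_integral (\<mu> - 1/2) (\<lambda>_ :: real ^ 'n. 1) * Beta (2 * \<mu> + \<beta> + real CARD('n)) (\<gamma> + 1)"
proof -
  define g where "g y = indicator (ball 0 1) y * ((1 - (norm y)\<^sup>2) powr (\<mu> - 1/2) * 1)" for y :: "real ^ 'n"
  define h :: "real \<Rightarrow> real" where "h t = indicator {0<..<1} t * (t powr (2 * \<mu> + \<beta> + CARD('n) - 1) * (1 - t) powr \<gamma>)" for t
  have g: "integrable lborel g"
    unfolding g_def using assms by (intro integrable_ball_powr_poly continuous_intros) auto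
  have h: "integrable lborel h"
    using integrable_Jacobi_weight_poly[of "2 * \<mu> + \<beta> + CARD('n) - 1" \<gamma> 1] assms unfolding h_def by simp
  have h0: "h t = 0" if "t \<le> 0" for t using that by (simp add: h_def)
  have eq: "indicator VV (x, t) * weight \<beta> \<gamma> \<mu> (x, t) = g (x /\<^sub>R t) * (h t / t ^ DIM(real ^ 'n))"
    for x :: "real ^ 'n" and t
  proof (cases "norm x < t \<and> t < 1")
    case True
    then have t: "0 < t" using norm_ge_zero[of x] by linarith
    have "norm (x /\<^sub>R t) < 1" using True t by (simp add: divide_simps)
    moreover have "(x, t) \<in> VV" using True t by (auto simp: VV_def)
    moreover have W: "weight \<beta> \<gamma> \<mu> (x, t) = (t powr (2 * (\<mu> - 1/2)) * t powr \<beta>)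
        * ((1 - (norm (x /\<^sub>R t))\<^sup>2) powr (\<mu> - 1/2) * (1 - t) powr \<gamma>)"
      using weight_polar[OF t, of x "\<mu> - 1/2"] True unfolding weight_def by (simp only: prod.case mult_ac)
    moreover have P: "t powr (2 * (\<mu> - 1/2)) * t powr \<beta> = t powr (2 * \<mu> + \<beta> + CARD('n) - 1) / t ^ CARD('n)"
    proof -
      have "t powr (2 * (\<mu> - 1/2)) * t powr \<beta> = t powr (2 * \<mu> + \<beta> - 1)"
      proof -
        have "2 * (\<mu> - 1/2) + \<beta> = 2 * \<mu> + \<beta> - 1" by simp
        then show ?thesis by (simp only: powr_add[symmetric])
      qed
      also have "2 * \<mu> + \<beta> - 1 = (2 * \<mu> + \<beta> + CARD('n) - 1) - real CARD('n)" by simp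
      finally show ?thesis
        using t unfolding powr_diff[of t "2 * \<mu> + \<beta> + CARD('n) - 1" "real CARD('n)"]
        by (simp add: powr_realpow)
    qed
    ultimately show ?thesis
      unfolding W P using True t by (simp add: g_def h_def)
  next
    case False
    then have "g (x /\<^sub>R t) * (h t / t ^ DIM(real ^ 'n)) = 0"
      by (cases "0 < t \<and> t < 1") (auto simp: g_def h_def divide_simps indicator_def)
    then show ?thesis using weight_eq_0_boundary[OF _ False] by (simp add: indicator_def)
  qed
  then have eq': "(\<lambda>p :: (real ^ 'n) \<times> real. indicator VV p * weight \<beta> \<gamma> \<mu> p) = (\<lambda>(x, t). g (x /\<^sub>R t) * (h t / t ^ DIM(real ^ 'n)))"
    by (auto simp: fun_eq_iff)
  show "integrable lborel (\<lambda>p :: (real ^ 'n) \<times> real. indicator VV p * weight \<beta> \<gamma> \<mu> p)"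
    unfolding eq' by (rule cone_integral_product(1)[OF g h h0])
  have "(LINT p:(VV :: ((real ^ 'n) \<times> real) set)|lborel. weight \<beta> \<gamma> \<mu> p) = integral\<^sup>L lborel g * integral\<^sup>L lborel h"
    unfolding set_lebesgue_integral_def real_scaleR_def eq' by (rule cone_integral_product(2)[OF g h h0])
  also have "integral\<^sup>L lborel g = ball_integral (\<mu> - 1/2) (\<lambda>_ :: real ^ 'n. 1)"
    unfolding g_def ball_integral_def ..
  also have "integral\<^sup>L lborel h = Beta (2 * \<mu> + \<beta> + CARD('n)) (\<gamma> + 1)"
    using integral_Jacobi_weight[of "2 * \<mu> + \<beta> + CARD('n) - 1" \<gamma>] assms unfolding h_def by simp
  finally show "(LINT p:(VV :: ((real ^ 'n) \<times> real) set)|lborel. weight \<beta> \<gamma> \<mu> p)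
      = ball_integral (\<mu> - 1/2) (\<lambda>_ :: real ^ 'n. 1) * Beta (2 * \<mu> + \<beta> + real CARD('n)) (\<gamma> + 1)" .
qed

lemma continuous_weight_integrable:
  fixes f :: "(real ^ 'n::finite) \<times> real \<Rightarrow> real"
  assumes "\<mu> > - 1/2" "\<gamma> > - 1" "2 * \<mu> + \<beta> + real CARD('n) > 0" and f: "continuous_on UNIV f"
  shows "integrable lborel (\<lambda>p. indicator VV p * (f p * weight \<beta> \<gamma> \<mu> p))"
proof -
  have [measurable]: "f \<in> borel_measurable borel" using f by (rule borel_measurable_continuous_onI)
  have "compact (f ` VV)"
    using f compact_VV by (intro compact_continuous_image) (auto intro: continuous_on_subset)
  then obtain M where M: "\<And>p. p \<in> VV \<Longrightarrow> \<bar>f p\<bar> \<le> M"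
    by (metis bounded_iff compact_imp_bounded imageI real_norm_def)
  have "integrable lborel (\<lambda>p :: (real ^ 'n) \<times> real. M * (indicator VV p * weight \<beta> \<gamma> \<mu> p))"
    using weight_integrable[OF assms(1-3)] by simp
  then show ?thesis
  proof (rule Bochner_Integration.integrable_bound)
    show "AE p in lborel. norm (indicator VV p * (f p * weight \<beta> \<gamma> \<mu> p)) \<le> norm (M * (indicator VV p * weight \<beta> \<gamma> \<mu> p))"
    proof (rule AE_I2)
      fix p :: "(real ^ 'n) \<times> real"
      show "norm (indicator VV p * (f p * weight \<beta> \<gamma> \<mu> p)) \<le> norm (M * (indicator VV p * weight \<beta> \<gamma> \<mu> p))"
      proof (cases "p \<in> VV")
        case True
        then have "\<bar>f p\<bar> * \<bar>weight \<beta> \<gamma> \<mu> p\<bar> \<le> \<bar>M\<bar> * \<bar>weight \<beta> \<gamma> \<mu> p\<bar>"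
          using M[of p] by (intro mult_right_mono) auto
        then show ?thesis using True by (simp add: abs_mult)
      qed simp
    qed
  qed measurable
qed

section \<open>The inner product on the cone and orthogonal projection\<close>

lemma cone_inner_commute: "cone_inner \<beta> \<gamma> \<mu> f g = cone_inner \<beta> \<gamma> \<mu> g f"
  by (simp add: cone_inner_def mult.commute)

lemma cone_inner_diff_left:
  fixes f g h :: "(real ^ 'n::finite) \<times> real \<Rightarrow> real"
  assumes "\<mu> > - 1/2" "\<gamma> > - 1" "2 * \<mu> + \<beta> + real CARD('n) > 0"
    and "continuous_on UNIV f" "continuous_on UNIV g" "continuous_on UNIV h"
  shows "cone_inner \<beta> \<gamma> \<mu> (\<lambda>p. f p - g p) h = cone_inner \<beta> \<gamma> \<mu> f h - cone_inner \<beta> \<gamma> \<mu> g h"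
proof -
  have "integrable lborel (\<lambda>p. indicator VV p * ((f p * h p) * weight \<beta> \<gamma> \<mu> p))"
    "integrable lborel (\<lambda>p. indicator VV p * ((g p * h p) * weight \<beta> \<gamma> \<mu> p))"
    using assms by (auto intro!: continuous_weight_integrable continuous_on_mult)
  then show ?thesis
    unfolding cone_inner_def set_lebesgue_integral_def real_scaleR_def
    by (subst Bochner_Integration.integral_diff[symmetric]) (auto simp: algebra_simps)
qed

lemma cone_inner_cmult_left:
  "cone_inner \<beta> \<gamma> \<mu> (\<lambda>p. c * f p) h = c * cone_inner \<beta> \<gamma> \<mu> f h"
proof -
  have "indicator VV p * (c * f p * h p * weight \<beta> \<gamma> \<mu> p) = c * (indicator VV p * (f p * h p * weight \<beta> \<gamma> \<mu> p))" for p
    by simp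
  then show ?thesis
    unfolding cone_inner_def set_lebesgue_integral_def real_scaleR_def by (simp only: integral_mult_right_zero)
qed

lemma cone_inner_sum_left:
  fixes h :: "(real ^ 'n::finite) \<times> real \<Rightarrow> real"
  assumes "\<mu> > - 1/2" "\<gamma> > - 1" "2 * \<mu> + \<beta> + real CARD('n) > 0"
    and "\<And>x. x \<in> S \<Longrightarrow> continuous_on UNIV (e x)" "continuous_on UNIV h"
  shows "cone_inner \<beta> \<gamma> \<mu> (\<lambda>p. \<Sum>x\<in>S. c x * e x p) h = (\<Sum>x\<in>S. c x * cone_inner \<beta> \<gamma> \<mu> (e x) h)"
proof -
  have "integrable lborel (\<lambda>p. indicator VV p * ((e x p * h p) * weight \<beta> \<gamma> \<mu> p))" if "x \<in> S" for x
    using assms that by (auto intro!: continuous_weight_integrable continuous_on_mult)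
  moreover have "indicator VV p * ((\<Sum>x\<in>S. c x * e x p) * h p * weight \<beta> \<gamma> \<mu> p)
     = (\<Sum>x\<in>S. c x * (indicator VV p * ((e x p * h p) * weight \<beta> \<gamma> \<mu> p)))" for p
    by (simp add: sum_distrib_left sum_distrib_right mult_ac)
  ultimately show ?thesis
    unfolding cone_inner_def set_lebesgue_integral_def real_scaleR_def by simp
qed

lemma cone_inner_self_eq_0:
  fixes f :: "(real ^ 'n::finite) \<times> real \<Rightarrow> real"
  assumes "\<mu> > - 1/2" "\<gamma> > - 1" "2 * \<mu> + \<beta> + real CARD('n) > 0"
    and f: "continuous_on UNIV f" and "cone_inner \<beta> \<gamma> \<mu> f f = 0"
  shows "AE p in lborel. p \<in> VV \<longrightarrow> f p * weight \<beta> \<gamma> \<mu> p = 0"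
proof -
  have i: "integrable lborel (\<lambda>p. indicator VV p * ((f p * f p) * weight \<beta> \<gamma> \<mu> p))"
    using assms by (auto intro!: continuous_weight_integrable continuous_on_mult)
  have "0 \<le> indicator VV p * ((f p * f p) * weight \<beta> \<gamma> \<mu> p)" for p
    by (cases "p \<in> VV") (simp_all add: weight_nonneg)
  then have "AE p in lborel. indicator VV p * ((f p * f p) * weight \<beta> \<gamma> \<mu> p) = 0"
    using assms(5) unfolding cone_inner_def set_lebesgue_integral_def real_scaleR_def
    by (subst integral_nonneg_eq_0_iff_AE[OF i, symmetric])
       auto
  then show ?thesis by eventually_elim (auto simp: indicator_def split: if_splits)
qed

text \<open>The equality case that lets Gram-Schmidt run without linear independence: when the
  vector to be projected on has norm 0, it is already orthogonal to everything.\<close>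

lemma cone_inner_degenerate:
  fixes f :: "(real ^ 'n::finite) \<times> real \<Rightarrow> real"
  assumes "\<mu> > - 1/2" "\<gamma> > - 1" "2 * \<mu> + \<beta> + real CARD('n) > 0"
    and "continuous_on UNIV f" "continuous_on UNIV g" "cone_inner \<beta> \<gamma> \<mu> f f = 0"
  shows "cone_inner \<beta> \<gamma> \<mu> f g = 0"
proof -
  have "AE p in lborel. indicator VV p * (f p * g p * weight \<beta> \<gamma> \<mu> p) = 0"
    using cone_inner_self_eq_0[OF assms(1-4,6)] by eventually_elim (auto simp: indicator_def)
  then show ?thesis
    unfolding cone_inner_def set_lebesgue_integral_def real_scaleR_def by (rule integral_eq_zero_AE)
qed

text \<open>Gram-Schmidt by induction over \<open>S\<close>. The induction hypothesis is used twice,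
  to make both the new element \<open>e a\<close> and \<open>f\<close> orthogonal to the old ones,
  and a one-dimensional projection finishes.\<close>

lemma ex_cone_projection:
  fixes e :: "'b \<Rightarrow> (real ^ 'n::finite) \<times> real \<Rightarrow> real"
  assumes par: "\<mu> > - 1/2" "\<gamma> > - 1" "2 * \<mu> + \<beta> + real CARD('n) > 0"
    and "finite S" and e: "\<And>x. continuous_on UNIV (e x)" and "continuous_on UNIV f"
  shows "\<exists>c. \<forall>y\<in>S. cone_inner \<beta> \<gamma> \<mu> (\<lambda>p. f p - (\<Sum>x\<in>S. c x * e x p)) (e y) = 0"
  using assms(4,6)
proof (induction S arbitrary: f rule: finite_induct)
  case empty
  show ?case by simp
next
  case (insert a S)
  let ?B = "cone_inner \<beta> \<gamma> \<mu>"
  note ce = continuous_on_sum continuous_on_mult continuous_on_const e continuous_on_diff insert.prems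
  obtain c0 where c0: "\<And>y. y \<in> S \<Longrightarrow> ?B (\<lambda>p. e a p - (\<Sum>x\<in>S. c0 x * e x p)) (e y) = 0"
    using insert.IH[OF e[of a]] by blast
  obtain c1 where c1: "\<And>y. y \<in> S \<Longrightarrow> ?B (\<lambda>p. f p - (\<Sum>x\<in>S. c1 x * e x p)) (e y) = 0"
    using insert.IH[OF insert.prems] by blast
  define a' where "a' p = e a p - (\<Sum>x\<in>S. c0 x * e x p)" for p
  define f' where "f' p = f p - (\<Sum>x\<in>S. c1 x * e x p)" for p
  have ca: "continuous_on UNIV a'" unfolding a'_def by (intro ce)
  have cf: "continuous_on UNIV f'" unfolding f'_def by (intro ce)
  \<comment> \<open>The usual projection coefficient. If the denominator is 0, then
    \<open>?B f' a' = 0\<close> by degeneracy, and the orthogonality to \<open>a'\<close> holds all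
    the same.\<close>
  define l where "l = ?B f' a' / ?B a' a'"
  define g where "g p = f' p - l * a' p" for p
  have cg: "continuous_on UNIV g" unfolding g_def by (intro ce ca cf)
  have B_g: "?B g h = ?B f' h - l * ?B a' h" if "continuous_on UNIV h" for h
    unfolding g_def using that par cf ca
    by (subst cone_inner_diff_left) (auto simp: cone_inner_cmult_left intro!: ce)
  have gS: "?B g (e y) = 0" if "y \<in> S" for y
    using c0[OF that] c1[OF that] by (simp add: B_g[OF e] flip: a'_def f'_def)
  have "?B g a' = 0"
  proof (cases "?B a' a' = 0")
    case True
    then have "?B f' a' = 0"
      using cone_inner_degenerate[OF par ca cf] by (simp add: cone_inner_commute)
    with True show ?thesis by (simp add: B_g[OF ca])
  qed (simp add: B_g[OF ca] l_def)
  \<comment> \<open>\<open>a'\<close> differs from \<open>e a\<close> by a combination of old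
    elements, all orthogonal to \<open>g\<close>, so orthogonality passes from \<open>a'\<close> to
    \<open>e a\<close>.\<close>
  moreover have "?B g a' = ?B (e a) g - ?B (\<lambda>p. \<Sum>x\<in>S. c0 x * e x p) g"
    unfolding a'_def by (subst cone_inner_commute, rule cone_inner_diff_left[OF par]) (intro ce cg)+
  moreover have "?B (\<lambda>p. \<Sum>x\<in>S. c0 x * e x p) g = 0"
    using gS by (subst cone_inner_sum_left[OF par]) (auto intro: e cg simp: cone_inner_commute[of _ _ _ _ g])
  ultimately have ga: "?B g (e a) = 0" by (simp add: cone_inner_commute)
  have "g = (\<lambda>p. f p - (\<Sum>x\<in>insert a S. (if x = a then l else c1 x - l * c0 x) * e x p))"
  proof
    fix p
    have "(\<Sum>x\<in>insert a S. (if x = a then l else c1 x - l * c0 x) * e x p)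
       = l * e a p + (\<Sum>x\<in>S. (c1 x - l * c0 x) * e x p)"
      using insert.hyps by (auto intro!: sum.cong)
    also have "\<dots> = l * e a p + (\<Sum>x\<in>S. c1 x * e x p) - l * (\<Sum>x\<in>S. c0 x * e x p)"
      by (simp add: left_diff_distrib sum_subtractf sum_distrib_left mult.assoc)
    finally show "g p = f p - (\<Sum>x\<in>insert a S. (if x = a then l else c1 x - l * c0 x) * e x p)"
      by (simp add: g_def f'_def a'_def algebra_simps)
  qed
  with gS ga show ?case by (intro exI[of _ "\<lambda>x. if x = a then l else c1 x - l * c0 x"]) auto
qed

section \<open>Polynomials of bounded degree\<close>

lemma real_polynomial_function_cone_monomial:
  "real_polynomial_function (cone_monomial j i :: (real ^ 'n::finite) \<times> real \<Rightarrow> real)"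
proof -
  have "bounded_linear (\<lambda>p :: (real ^ 'n) \<times> real. fst p $ l)" for l
    by (rule bounded_linear_compose[OF bounded_linear_vec_nth bounded_linear_fst])
  then have "real_polynomial_function (\<lambda>p :: (real ^ 'n) \<times> real. snd p ^ i * mi_power (fst p) j)"
    unfolding mi_power_def
    by (intro real_polynomial_function.intros(4) real_polynomial_function_power real_polynomial_function_prod
        real_polynomial_function.intros(1)[OF bounded_linear_snd] real_polynomial_function.intros(1)) auto
  also have "(\<lambda>p :: (real ^ 'n) \<times> real. snd p ^ i * mi_power (fst p) j) = cone_monomial j i"
    by (auto simp: cone_monomial_def fun_eq_iff)
  finally show ?thesis .
qed

lemma finite_monomials: "finite {(j :: 'n::finite \<Rightarrow> nat, i). int (mi_deg j + i) \<le> m}"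
proof (rule finite_subset)
  show "finite ((\<Pi>\<^sub>E l\<in>(UNIV :: 'n set). {..nat m}) \<times> {..nat m})"
    by (intro finite_cartesian_product finite_PiE) auto
  show "{(j :: 'n \<Rightarrow> nat, i). int (mi_deg j + i) \<le> m} \<subseteq> (\<Pi>\<^sub>E l\<in>UNIV. {..nat m}) \<times> {..nat m}"
  proof clarify
    fix j :: "'n \<Rightarrow> nat" and i assume *: "int (mi_deg j + i) \<le> m"
    have le: "j l \<le> mi_deg j" for l
      unfolding mi_deg_def by (intro member_le_sum) auto
    have "j l \<le> nat m" for l using * le[of l] by linarith
    with * show "j \<in> (\<Pi>\<^sub>E l\<in>UNIV. {..nat m}) \<and> i \<in> {..nat m}" by auto
  qed
qed

lemma polys_deg_le_add:
  assumes "f \<in> polys_deg_le m" "g \<in> polys_deg_le m"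
  shows "(\<lambda>p. f p + g p) \<in> polys_deg_le m"
proof -
  obtain c d where "f = (\<lambda>p. \<Sum>(j, i) \<in> {(j, i). int (mi_deg j + i) \<le> m}. c j i * cone_monomial j i p)"
    "g = (\<lambda>p. \<Sum>(j, i) \<in> {(j, i). int (mi_deg j + i) \<le> m}. d j i * cone_monomial j i p)"
    using assms unfolding polys_deg_le_def by blast
  then show ?thesis
    unfolding polys_deg_le_def
    by (intro CollectI exI[of _ "\<lambda>j i. c j i + d j i"]) (simp add: fun_eq_iff sum.distrib[symmetric] distrib_right split_beta)
qed

lemma polys_deg_le_cmult:
  assumes "f \<in> polys_deg_le m"
  shows "(\<lambda>p. a * f p) \<in> polys_deg_le m"
proof -
  obtain c where "f = (\<lambda>p. \<Sum>(j, i) \<in> {(j, i). int (mi_deg j + i) \<le> m}. c j i * cone_monomial j i p)"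
    using assms unfolding polys_deg_le_def by blast
  then show ?thesis
    unfolding polys_deg_le_def
    by (intro CollectI exI[of _ "\<lambda>j i. a * c j i"]) (simp add: fun_eq_iff sum_distrib_left mult.assoc split_beta)
qed

lemma polys_deg_le_diff:
  assumes "f \<in> polys_deg_le m" "g \<in> polys_deg_le m"
  shows "(\<lambda>p. f p - g p) \<in> polys_deg_le m"
  using polys_deg_le_add[OF assms(1) polys_deg_le_cmult[OF assms(2), of "-1"]] by simp

lemma polys_deg_le_mono:
  assumes "m \<le> m'"
  shows "polys_deg_le m \<subseteq> polys_deg_le m'"
proof
  fix f :: "(real ^ 'n) \<times> real \<Rightarrow> real" assume "f \<in> polys_deg_le m"
  then obtain c where f: "f = (\<lambda>p. \<Sum>(j, i) \<in> {(j, i). int (mi_deg j + i) \<le> m}. c j i * cone_monomial j i p)"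
    unfolding polys_deg_le_def by blast
  have "f = (\<lambda>p. \<Sum>(j, i) \<in> {(j, i). int (mi_deg j + i) \<le> m'}.
      (if int (mi_deg j + i) \<le> m then c j i else 0) * cone_monomial j i p)"
    unfolding f
    by (rule ext, rule sum.mono_neutral_cong_left[OF finite_monomials]) (use assms in \<open>auto split: if_splits\<close>)
  then show "f \<in> polys_deg_le m'"
    unfolding polys_deg_le_def
    by (intro CollectI exI[of _ "\<lambda>j i. if int (mi_deg j + i) \<le> m then c j i else 0"])
qed

lemma cone_monomial_in_polys_deg_le:
  assumes "int (mi_deg j + i) \<le> m"
  shows "(cone_monomial j i :: (real ^ 'n::finite) \<times> real \<Rightarrow> real) \<in> polys_deg_le m"
proof -
  have "cone_monomial j i p = (\<Sum>(j', i') \<in> {(j, i). int (mi_deg j + i) \<le> m}.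
      (if (j', i') = (j, i) then 1 else 0) * cone_monomial j' i' p)" for p :: "(real ^ 'n) \<times> real"
  proof -
    have "(\<Sum>(j', i') \<in> {(j, i). int (mi_deg j + i) \<le> m}. (if (j', i') = (j, i) then 1 else 0) * cone_monomial j' i' p)
      = (\<Sum>x \<in> {(j, i). int (mi_deg j + i) \<le> m}. if x = (j, i) then cone_monomial j i p else 0)"
      by (intro sum.cong) (auto split: if_splits)
    also have "\<dots> = cone_monomial j i p"
      using assms by (subst sum.delta[OF finite_monomials]) auto
    finally show ?thesis ..
  qed
  then show ?thesis unfolding polys_deg_le_def by (intro CollectI exI[of _ "\<lambda>j' i'. if (j', i') = (j, i) then 1 else 0"]) (auto simp: fun_eq_iff)
qed

lemma polys_deg_le_real_polynomial_function:
  assumes "f \<in> polys_deg_le m"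
  shows "real_polynomial_function f"
proof -
  obtain c where "f = (\<lambda>p. \<Sum>(j, i) \<in> {(j, i). int (mi_deg j + i) \<le> m}. c j i * cone_monomial j i p)"
    using assms unfolding polys_deg_le_def by blast
  then have eq: "f = (\<lambda>p. \<Sum>x \<in> {(j, i). int (mi_deg j + i) \<le> m}. c (fst x) (snd x) * cone_monomial (fst x) (snd x) p)"
    by (simp add: split_beta)
  show ?thesis
    unfolding eq
    by (intro real_polynomial_function_sum finite_monomials real_polynomial_function.intros(4)
        real_polynomial_function.intros(2) real_polynomial_function_cone_monomial)
qed

text \<open>On the line from \<open>u\<close> to \<open>p\<close> the function is a univariate
  polynomial. It vanishes for all parameters near 0, hence has infinitely many roots, hence is 0 at
  parameter 1 as well.\<close>

lemma real_polynomial_function_zero_on_open: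
  fixes f :: "'a::euclidean_space \<Rightarrow> real"
  assumes f: "real_polynomial_function f" and U: "open U" "u \<in> U" "\<And>p. p \<in> U \<Longrightarrow> f p = 0"
  shows "f p = 0"
proof -
  define w where "w s = u + s *\<^sub>R (p - u)" for s :: real
  have "polynomial_function w"
    unfolding w_def by (intro polynomial_function_add polynomial_function_mult polynomial_function_const polynomial_function_id)
  then have "real_polynomial_function (f \<circ> w)"
    using f by (rule real_polynomial_function_compose)
  then obtain a n where a: "f \<circ> w = (\<lambda>s. \<Sum>i\<le>n. a i * s ^ i)"
    unfolding real_polynomial_function_iff_sum by blast
  define Q where "Q = (\<Sum>i\<le>n. monom (a i) i)"
  have Q: "poly Q s = f (w s)" for s
    using fun_cong[OF a, of s] by (simp add: Q_def poly_sum poly_monom)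
  have "open (w -` U)"
    unfolding w_def by (intro open_vimage U continuous_intros)
  moreover have "0 \<in> w -` U" using U by (simp add: w_def)
  ultimately have "infinite (w -` U)"
    using open_not_negligible negligible_finite by blast
  moreover have "w -` U \<subseteq> {s. poly Q s = 0}"
    using U(3) by (auto simp: Q)
  ultimately have "Q = 0" using poly_roots_finite finite_subset by blast
  with Q[of 1] show ?thesis by (simp add: w_def)
qed

text \<open>The weight is positive in the interior of the cone, so the set where \<open>f\<close>
  does not vanish there is null. Being open, it is empty, and a polynomial that is 0 on a nonempty
  open set is 0.\<close>

lemma cone_inner_polynomial_definite:
  fixes f :: "(real ^ 'n::finite) \<times> real \<Rightarrow> real"
  assumes par: "\<mu> > - 1/2" "\<gamma> > - 1" "2 * \<mu> + \<beta> + real CARD('n) > 0"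
    and f: "real_polynomial_function f" and 0: "cone_inner \<beta> \<gamma> \<mu> f f = 0"
  shows "f p = 0"
proof -
  let ?U = "{p :: (real ^ 'n) \<times> real. norm (fst p) < snd p} \<inter> {p. snd p < 1}"
  have cf: "continuous_on UNIV f" using f by (rule real_polynomial_function_continuous_on)
  have opU: "open ?U" by (intro open_Int open_Collect_less continuous_intros)
  have W: "p \<in> VV \<and> weight \<beta> \<gamma> \<mu> p > 0" if "p \<in> ?U" for p
  proof -
    obtain x t where p: "p = (x, t)" by force
    have xt: "norm x < t" "t < 1" using that p by auto
    then have "0 < t" using norm_ge_zero[of x] by linarith
    moreover have "(norm x)\<^sup>2 < t\<^sup>2" using xt by (intro power_strict_mono) auto
    ultimately show ?thesis using xt by (auto simp: p VV_def weight_def)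
  qed
  let ?N = "{p \<in> ?U. f p \<noteq> 0}"
  have "?N = ?U \<inter> f -` (- {0})" by auto
  then have opN: "open ?N"
    using opU cf by (auto intro!: open_Int open_vimage)
  have "AE p in lborel. p \<notin> ?N"
    using cone_inner_self_eq_0[OF par cf 0] by eventually_elim (use W in fastforce)
  then have "?N \<in> null_sets lborel"
    using opN by (subst (asm) AE_iff_null_sets[symmetric]) auto
  then have "negligible ?N"
    by (simp add: negligible_iff_null_sets null_sets_completionI)
  then have N: "?N = {}" using open_not_negligible[OF opN] by blast
  have "(0, 1/2) \<in> ?U" by simp
  from real_polynomial_function_zero_on_open[OF f opU this] N show ?thesis by blast
qed

text \<open>\<open>VJ\<close> is a definite description, so unfolding it takes both existence and
  uniqueness. Subtracting from the monomial its projection onto lower degree gives a candidate;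
  definiteness on polynomials makes it the only one.\<close>

lemma VJ_expansion:
  fixes j :: "'n::finite \<Rightarrow> nat"
  assumes par: "\<mu> > - 1/2" "\<gamma> > - 1" "2 * \<mu> + \<beta> + real CARD('n) > 0"
    and j: "mi_deg j \<le> n"
  shows "\<exists>c. VJ \<beta> \<gamma> \<mu> j n = (\<lambda>p. cone_monomial j (n - mi_deg j) p
    + (\<Sum>(j, i) \<in> {(j, i). int (mi_deg j + i) \<le> int n - 1}. c j i * cone_monomial j i p))"
proof -
  let ?S = "{(j :: 'n \<Rightarrow> nat, i). int (mi_deg j + i) \<le> int n - 1}"
  let ?m = "cone_monomial j (n - mi_deg j)"
  define e where "e = (\<lambda>(j :: 'n \<Rightarrow> nat, i). cone_monomial j i)"
  have ce: "continuous_on UNIV (e x)" for x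
    by (auto simp: e_def split_beta intro!: real_polynomial_function_continuous_on real_polynomial_function_cone_monomial)
  have cm: "continuous_on UNIV ?m"
    by (intro real_polynomial_function_continuous_on real_polynomial_function_cone_monomial)
  obtain c where c: "\<And>y. y \<in> ?S \<Longrightarrow> cone_inner \<beta> \<gamma> \<mu> (\<lambda>p. ?m p - (\<Sum>x\<in>?S. c x * e x p)) (e y) = 0"
    using ex_cone_projection[where e = e, OF par finite_monomials[of "int n - 1"] ce cm] by blast
  define V where "V p = ?m p - (\<Sum>x\<in>?S. c x * e x p)" for p
  have cV: "cone_inner \<beta> \<gamma> \<mu> (e y) V = 0" if "y \<in> ?S" for y
    using c[OF that] unfolding V_def by (subst cone_inner_commute)
  have sum_in: "(\<lambda>p. \<Sum>x\<in>?S. c x * e x p) \<in> polys_deg_le (int n - 1)" for c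
    unfolding polys_deg_le_def
    by (intro CollectI exI[of _ "\<lambda>j i. c (j, i)"]) (auto simp: e_def split_beta)
  have Vn: "V \<in> polys_deg_le (int n)"
    unfolding V_def using j polys_deg_le_mono[of "int n - 1" "int n"] sum_in
    by (intro polys_deg_le_diff cone_monomial_in_polys_deg_le) auto
  have cont: "continuous_on UNIV f" if "f \<in> polys_deg_le m" for f :: "(real ^ 'n) \<times> real \<Rightarrow> real" and m
    using that by (intro real_polynomial_function_continuous_on polys_deg_le_real_polynomial_function)
  have Vorth: "V \<in> orth_polys n \<beta> \<gamma> \<mu>"
    unfolding orth_polys_def
  proof (intro CollectI conjI ballI Vn)
    fix g :: "(real ^ 'n) \<times> real \<Rightarrow> real" assume "g \<in> polys_deg_le (int n - 1)"
    then obtain d where "g = (\<lambda>p. \<Sum>(j, i) \<in> ?S. d j i * cone_monomial j i p)"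
      unfolding polys_deg_le_def by blast
    then have g: "g = (\<lambda>p. \<Sum>x\<in>?S. (case x of (j, i) \<Rightarrow> d j i) * e x p)"
      by (simp add: e_def split_beta)
    have "cone_inner \<beta> \<gamma> \<mu> g V = 0"
      unfolding g by (subst cone_inner_sum_left[OF par ce cont[OF Vn]], rule sum.neutral) (simp add: cV)
    then show "cone_inner \<beta> \<gamma> \<mu> V g = 0" by (simp add: cone_inner_commute)
  qed
  have Vlead: "(\<lambda>p. V p - ?m p) \<in> polys_deg_le (int n - 1)"
    using polys_deg_le_cmult[OF sum_in[of c], of "-1"] by (simp add: V_def)
  have "VJ \<beta> \<gamma> \<mu> j n = V"
    unfolding VJ_def
  proof (rule the_equality)
    fix f assume f: "f \<in> orth_polys n \<beta> \<gamma> \<mu> \<and> (\<lambda>p. f p - ?m p) \<in> polys_deg_le (int n - 1)"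
    let ?h = "\<lambda>p. f p - V p"
    have h: "?h \<in> polys_deg_le (int n - 1)"
      using polys_deg_le_diff[OF conjunct2[OF f] Vlead] by simp
    have fn: "f \<in> polys_deg_le (int n)" using f by (simp add: orth_polys_def)
    \<comment> \<open>The leading monomials cancel in \<open>?h\<close>, so it belongs to the
      lower-degree space to which both \<open>f\<close> and \<open>V\<close> are orthogonal; in
      particular it is orthogonal to itself.\<close>
    have "cone_inner \<beta> \<gamma> \<mu> ?h ?h = cone_inner \<beta> \<gamma> \<mu> f ?h - cone_inner \<beta> \<gamma> \<mu> V ?h"
      by (intro cone_inner_diff_left par cont[OF fn] cont[OF Vn] cont[OF h])
    also have "\<dots> = 0" using f Vorth h by (simp add: orth_polys_def)
    finally have "?h p = 0" for p
      by (rule cone_inner_polynomial_definite[OF par polys_deg_le_real_polynomial_function[OF h]])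
    then show "f = V" by (simp add: fun_eq_iff)
  qed (use Vorth Vlead in simp)
  then show ?thesis
    by (intro exI[of _ "\<lambda>j i. - c (j, i)"]) (auto simp: V_def e_def fun_eq_iff split_beta sum_negf)
qed

section \<open>Integrals against monomials\<close>

lemma Beta_pochhammer:
  fixes p q :: real
  assumes "p > 0" "q > 0"
  shows "Beta (p + real r) (q + real s) * pochhammer (p + q) (r + s)
    = Beta p q * pochhammer p r * pochhammer q s"
proof -
  have "p \<notin> \<int>\<^sub>\<le>\<^sub>0" "q \<notin> \<int>\<^sub>\<le>\<^sub>0" "p + q \<notin> \<int>\<^sub>\<le>\<^sub>0"
    using assms by (auto dest: nonpos_Ints_nonpos)
  then have "Gamma (p + r) = pochhammer p r * Gamma p" "Gamma (q + s) = pochhammer q s * Gamma q"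
    "Gamma (p + real r + (q + real s)) = pochhammer (p + q) (r + s) * Gamma (p + q)"
    by (simp_all add: pochhammer_Gamma Gamma_eq_zero_iff add_ac)
  moreover have "pochhammer (p + q) (r + s) > 0"
    using assms by (intro pochhammer_pos) auto
  ultimately show ?thesis
    unfolding Beta_def by (simp add: mult_ac)
qed

lemma mi_power_scaleR:
  "mi_power (c *\<^sub>R x) j = c ^ mi_deg j * mi_power x j"
  by (simp add: mi_power_def mi_deg_def power_mult_distrib prod.distrib power_sum)

text \<open>The factor \<open>1 / weight\<close> in \<open>UJ\<close> cancels the weight in the
  interior, and after dilation the rest separates. The power of \<open>t\<close> is kept as
  \<open>powr\<close> with a real exponent, since \<open>mi_deg j + i\<close> may be smaller than
  \<open>mi_deg k\<close> when \<open>k \<le> j\<close> fails.\<close>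

lemma
  fixes \<mu> \<beta> \<gamma> :: real and n :: nat and k j :: "'n::finite \<Rightarrow> nat"
  assumes par: "\<mu> > - 1/2" "\<gamma> > - 1" "2 * \<mu> + \<beta> + real CARD('n) > 0"
    and k: "mi_deg k \<le> n"
  defines "D \<equiv> (deriv ^^ (n - mi_deg k))
         (\<lambda>s. s powr (real n + real (mi_deg k) + \<beta> + 2 * \<mu> + real CARD('n) - 1)
              * (1 - s) powr (\<gamma> + real n - real (mi_deg k)))"
  shows UJ_cone_monomial_integrable:
      "integrable lborel (\<lambda>p. indicator VV p * (UJ \<beta> \<gamma> \<mu> k n p * cone_monomial j i p * weight \<beta> \<gamma> \<mu> p))"
    and UJ_cone_monomial_integral:
      "(\<integral>p. indicator VV p * (UJ \<beta> \<gamma> \<mu> k n p * cone_monomial j i p * weight \<beta> \<gamma> \<mu> p) \<partial>lborel)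
       = (-1) ^ mi_deg k * (\<Prod>l\<in>UNIV. fact (k l) * real (j l choose k l))
         * ball_integral (\<mu> - 1/2 + real (mi_deg k)) (\<lambda>y. mi_power y (\<lambda>l. j l - k l))
         * (\<integral>t. indicator {0<..<1} t * (t powr (real (mi_deg j + i) - real (mi_deg k)) * D t) \<partial>lborel)"
proof -
  define a where "a = \<mu> - 1/2 + real (mi_deg k)"
  obtain ds where ds: "\<And>i. count_list ds i = k i" "length ds = mi_deg k"
    "\<And>f :: real ^ 'n \<Rightarrow> real. mi_deriv k f = foldr partial_deriv ds f"
    using mi_deriv_direction_list[of k] by blast
  have len: "real (length ds) < a + 1" using par by (simp add: a_def ds)
  obtain q :: "real ^ 'n \<Rightarrow> real" where q: "real_polynomial_function q"
    "\<And>y. norm y < 1 \<Longrightarrow> foldr partial_deriv ds (\<lambda>y. (1 - (norm y)\<^sup>2) powr a) y = (1 - (norm y)\<^sup>2) powr (\<mu> - 1/2) * q y"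
    "ball_integral (\<mu> - 1/2) (\<lambda>y. q y * mi_power y j)
          = (-1) ^ mi_deg k * (\<Prod>l\<in>UNIV. fact (k l) * real (j l choose k l))
            * ball_integral a (\<lambda>y. mi_power y (\<lambda>l. j l - k l))"
  proof -
    have "a - real (mi_deg k) = \<mu> - 1/2" by (simp add: a_def)
    from iterated_partial_ball_powr[OF len, unfolded ds(1,2) this] show thesis
      by (elim exE conjE) (rule that, blast+)
  qed
  obtain P where P: "\<And>t. 0 < t \<Longrightarrow> t < 1 \<Longrightarrow>
     D t = t powr (2 * real (mi_deg k) + \<beta> + 2 * \<mu> + real CARD('n) - 1) * (1 - t) powr \<gamma> * poly P t"
  proof -
    let ?b = "real n + real (mi_deg k) + \<beta> + 2 * \<mu> + real CARD('n) - 1"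
    let ?c = "\<gamma> + real n - real (mi_deg k)"
    have "?b - real (n - mi_deg k) = 2 * real (mi_deg k) + \<beta> + 2 * \<mu> + real CARD('n) - 1"
      "?c - real (n - mi_deg k) = \<gamma>"
      using k by (simp_all add: of_nat_diff)
    from iterated_deriv_Jacobi_weight[of "n - mi_deg k" ?b ?c, unfolded this, folded D_def] show thesis
      by (elim exE) (rule that, blast)
  qed
  define g where "g y = indicator (ball 0 1) y * ((1 - (norm y)\<^sup>2) powr (\<mu> - 1/2) * (q y * mi_power y j))" for y
  define h :: "real \<Rightarrow> real" where
    "h t = indicator {0<..<1} t * (t powr (real (mi_deg j + i) - real (mi_deg k)) * D t)" for t
  have g: "integrable lborel g"
    unfolding g_def using par q(1)
    by (intro integrable_ball_powr_poly real_polynomial_function_continuous_on real_polynomial_function.intros(4)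
        real_polynomial_function_mi_power) auto
  \<comment> \<open>Even a negative exponent does no harm: \<open>D\<close> supplies enough powers
    of \<open>t\<close> to bring the total exponent to \<open>mi_deg j + i + mi_deg k\<close> plus
    \<open>2 * \<mu> + \<beta> + real CARD('n) - 1\<close>, which exceeds -1.\<close>
  have h: "integrable lborel h"
  proof -
    have "h = (\<lambda>t. indicator {0<..<1} t * (t powr (real (mi_deg j + i) + real (mi_deg k) + \<beta> + 2 * \<mu> + real CARD('n) - 1) * (1 - t) powr \<gamma> * poly P t))"
    proof
      fix t
      have "t powr (real (mi_deg j + i) - real (mi_deg k)) * t powr (2 * real (mi_deg k) + \<beta> + 2 * \<mu> + real CARD('n) - 1)
        = t powr (real (mi_deg j + i) + real (mi_deg k) + \<beta> + 2 * \<mu> + real CARD('n) - 1)"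
        unfolding powr_add[symmetric] by (rule arg_cong[where f = "\<lambda>u. t powr u"]) linarith
      then show "h t = indicator {0<..<1} t * (t powr (real (mi_deg j + i) + real (mi_deg k) + \<beta> + 2 * \<mu> + real CARD('n) - 1) * (1 - t) powr \<gamma> * poly P t)"
        by (cases "t \<in> {0<..<1}") (auto simp: h_def P mult.assoc[symmetric])
    qed
    then show ?thesis
      using integrable_Jacobi_weight_poly par by simp
  qed
  have h0: "h t = 0" if "t \<le> 0" for t using that by (simp add: h_def)
  have eq: "indicator VV (x, t) * (UJ \<beta> \<gamma> \<mu> k n (x, t) * cone_monomial j i (x, t) * weight \<beta> \<gamma> \<mu> (x, t))
      = g (x /\<^sub>R t) * (h t / t ^ DIM(real ^ 'n))" for x :: "real ^ 'n" and t
  proof (cases "norm x < t \<and> t < 1")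
    case True
    then have t: "0 < t" using norm_ge_zero[of x] by linarith
    have y: "norm (x /\<^sub>R t) < 1" using True t by (simp add: divide_simps)
    have VV: "(x, t) \<in> VV" using True t by (auto simp: VV_def)
    have "(norm x)\<^sup>2 < t\<^sup>2" using True by (intro power_strict_mono) auto
    then have W: "weight \<beta> \<gamma> \<mu> (x, t) \<noteq> 0" using True t by (simp add: weight_def)
    have mo: "cone_monomial j i (x, t) = t powr real (mi_deg j + i) * mi_power (x /\<^sub>R t) j"
    proof -
      have "mi_power x j = t ^ mi_deg j * mi_power (x /\<^sub>R t) j"
        using mi_power_scaleR[of t "x /\<^sub>R t" j] t by simp
      moreover have "t powr real (mi_deg j + i) = t ^ mi_deg j * t ^ i"
        using powr_realpow[OF t, of "mi_deg j + i"] by (simp only: power_add)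
      ultimately show ?thesis by (simp add: cone_monomial_def)
    qed
    have der: "mi_deriv k (\<lambda>y. (t\<^sup>2 - (norm y)\<^sup>2) powr (real (mi_deg k) + \<mu> - 1/2)) x
       = t powr (real (mi_deg k) + 2 * \<mu> - 1) * ((1 - (norm (x /\<^sub>R t))\<^sup>2) powr (\<mu> - 1/2) * q (x /\<^sub>R t))"
    proof -
      have e: "real (mi_deg k) + \<mu> - 1/2 = a" "2 * a - real (length ds) = real (mi_deg k) + 2 * \<mu> - 1"
        by (simp_all add: a_def ds)
      show ?thesis
        using iterated_partial_scaling[OF t len, of x] True unfolding ds(3) e q(2)[OF y] by simp
    qed
    have UW: "UJ \<beta> \<gamma> \<mu> k n (x, t) * weight \<beta> \<gamma> \<mu> (x, t)
       = (1 / t powr (2 * real (mi_deg k) + 2 * \<mu> + real CARD('n) - 1))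
         * mi_deriv k (\<lambda>y. (t\<^sup>2 - (norm y)\<^sup>2) powr (real (mi_deg k) + \<mu> - 1/2)) x * D t"
      using W by (simp add: UJ_def D_def)
    have "UJ \<beta> \<gamma> \<mu> k n (x, t) * cone_monomial j i (x, t) * weight \<beta> \<gamma> \<mu> (x, t)
       = (UJ \<beta> \<gamma> \<mu> k n (x, t) * weight \<beta> \<gamma> \<mu> (x, t)) * cone_monomial j i (x, t)"
      by (simp only: mult_ac)
    also have "\<dots> = ((1 / t powr (2 * real (mi_deg k) + 2 * \<mu> + real CARD('n) - 1)) * t powr (real (mi_deg k) + 2 * \<mu> - 1) * t powr real (mi_deg j + i))
         * (1 - (norm (x /\<^sub>R t))\<^sup>2) powr (\<mu> - 1/2) * q (x /\<^sub>R t) * mi_power (x /\<^sub>R t) j * D t"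
      unfolding UW der mo by (simp only: mult_ac)
    \<comment> \<open>The three powers come from the prefactor of \<open>UJ\<close>, the scaled
      derivative and the monomial. The surplus exponent \<open>- real CARD('n)\<close> is the
      inverse Jacobian expected by \<open>cone_integral_product\<close>.\<close>
    also have "(1 / t powr (2 * real (mi_deg k) + 2 * \<mu> + real CARD('n) - 1)) * t powr (real (mi_deg k) + 2 * \<mu> - 1) * t powr real (mi_deg j + i)
       = t powr ((real (mi_deg j + i) - real (mi_deg k)) - real CARD('n))"
    proof -
      have "(1 / t powr (2 * real (mi_deg k) + 2 * \<mu> + real CARD('n) - 1)) = t powr (- (2 * real (mi_deg k) + 2 * \<mu> + real CARD('n) - 1))"
        by (rule powr_minus_divide[symmetric])
      then show ?thesis
        by (simp only: powr_add[symmetric]) (rule arg_cong[where f = "\<lambda>u. t powr u"], linarith)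
    qed
    also have "\<dots> = t powr (real (mi_deg j + i) - real (mi_deg k)) / t ^ CARD('n)"
      by (simp only: powr_diff[of t _ "real CARD('n)"] powr_realpow[OF t])
    finally show ?thesis
      using VV True t y by (simp add: g_def h_def)
  next
    case False
    then have "g (x /\<^sub>R t) * (h t / t ^ DIM(real ^ 'n)) = 0"
      by (cases "0 < t \<and> t < 1") (auto simp: g_def h_def divide_simps indicator_def)
    then show ?thesis using weight_eq_0_boundary[OF _ False] by (simp add: indicator_def)
  qed
  then have eq': "(\<lambda>p. indicator VV p * (UJ \<beta> \<gamma> \<mu> k n p * cone_monomial j i p * weight \<beta> \<gamma> \<mu> p))
      = (\<lambda>(x, t). g (x /\<^sub>R t) * (h t / t ^ DIM(real ^ 'n)))"
    by (auto simp: fun_eq_iff)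
  show "integrable lborel (\<lambda>p. indicator VV p * (UJ \<beta> \<gamma> \<mu> k n p * cone_monomial j i p * weight \<beta> \<gamma> \<mu> p))"
    unfolding eq' by (rule cone_integral_product(1)[OF g h h0])
  have "(\<integral>p. indicator VV p * (UJ \<beta> \<gamma> \<mu> k n p * cone_monomial j i p * weight \<beta> \<gamma> \<mu> p) \<partial>lborel)
      = integral\<^sup>L lborel g * integral\<^sup>L lborel h"
    unfolding eq' by (rule cone_integral_product(2)[OF g h h0])
  also have "integral\<^sup>L lborel g = ball_integral (\<mu> - 1/2) (\<lambda>y. q y * mi_power y j)"
    unfolding g_def ball_integral_def ..
  finally show "(\<integral>p. indicator VV p * (UJ \<beta> \<gamma> \<mu> k n p * cone_monomial j i p * weight \<beta> \<gamma> \<mu> p) \<partial>lborel)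
       = (-1) ^ mi_deg k * (\<Prod>l\<in>UNIV. fact (k l) * real (j l choose k l))
         * ball_integral (\<mu> - 1/2 + real (mi_deg k)) (\<lambda>y. mi_power y (\<lambda>l. j l - k l))
         * (\<integral>t. indicator {0<..<1} t * (t powr (real (mi_deg j + i) - real (mi_deg k)) * D t) \<partial>lborel)"
    unfolding q(3) a_def h_def .
qed

lemma UJ_cone_monomial_choose_eq_0:
  fixes j k :: "'n::finite \<Rightarrow> nat"
  assumes "\<not> k \<le> j"
  shows "(\<Prod>l\<in>UNIV. fact (k l) * real (j l choose k l)) = 0"
proof -
  obtain l where "j l < k l" using assms by (auto simp: le_fun_def not_le)
  then show ?thesis by (intro prod_zero) auto
qed

lemma mi_deg_mono: "k \<le> j \<Longrightarrow> mi_deg k \<le> mi_deg j"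
  unfolding mi_deg_def by (intro sum_mono) (auto simp: le_fun_def)

lemma mi_deg_eq_imp_eq:
  assumes "k \<le> j" "mi_deg j \<le> mi_deg k"
  shows "k = j"
proof (rule ccontr)
  assume "k \<noteq> j"
  then obtain l where "k l \<noteq> j l" by auto
  with assms(1) have "k l < j l" by (simp add: le_fun_def order_less_le)
  with assms(1) have "mi_deg k < mi_deg j"
    unfolding mi_deg_def by (intro sum_strict_mono_ex1) (auto simp: le_fun_def)
  with assms(2) show False by simp
qed

text \<open>If \<open>k \<le> j\<close>, the exponent of \<open>t\<close> is a natural number, at
  most \<open>n - mi_deg k\<close> by the degree bound, and reaches this value only for
  \<open>mi_deg j + i = n\<close>. Otherwise a binomial coefficient vanishes and the integral over
  \<open>t\<close> needs no value.\<close>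

lemma UJ_cone_monomial_integral_nat:
  fixes \<mu> \<beta> \<gamma> :: real and n :: nat and k j :: "'n::finite \<Rightarrow> nat"
  assumes par: "\<mu> > - 1/2" "\<gamma> > - 1" "2 * \<mu> + \<beta> + real CARD('n) > 0"
    and k: "mi_deg k \<le> n" and ji: "mi_deg j + i \<le> n"
  shows "(\<integral>p. indicator VV p * (UJ \<beta> \<gamma> \<mu> k n p * cone_monomial j i p * weight \<beta> \<gamma> \<mu> p) \<partial>lborel)
       = (-1) ^ mi_deg k * (\<Prod>l\<in>UNIV. fact (k l) * real (j l choose k l))
         * ball_integral (\<mu> - 1/2 + real (mi_deg k)) (\<lambda>y. mi_power y (\<lambda>l. j l - k l))
         * (if mi_deg j + i = n then (-1) ^ (n - mi_deg k) * fact (n - mi_deg k)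
              * Beta (2 * \<mu> + \<beta> + real CARD('n) + real (n + mi_deg k)) (\<gamma> + 1 + real (n - mi_deg k)) else 0)"
proof (cases "k \<le> j")
  case False
  then show ?thesis
    by (simp add: UJ_cone_monomial_integral[OF par k] UJ_cone_monomial_choose_eq_0)
next
  case True
  let ?b = "real n + real (mi_deg k) + \<beta> + 2 * \<mu> + real CARD('n) - 1"
  let ?c = "\<gamma> + real n - real (mi_deg k)"
  let ?D = "(deriv ^^ (n - mi_deg k)) (\<lambda>s. s powr ?b * (1 - s) powr ?c)"
  have kj: "mi_deg k \<le> mi_deg j + i" using mi_deg_mono[OF True] by simp
  have "(\<lambda>t. indicator {0<..<1} t * (t powr (real (mi_deg j + i) - real (mi_deg k)) * ?D t))
     = (\<lambda>t. indicator {0<..<1} t * (t ^ (mi_deg j + i - mi_deg k) * ?D t))"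
  proof
    fix t :: real
    show "indicator {0<..<1} t * (t powr (real (mi_deg j + i) - real (mi_deg k)) * ?D t)
       = indicator {0<..<1} t * (t ^ (mi_deg j + i - mi_deg k) * ?D t)"
      using kj by (cases "t \<in> {0<..<1}") (auto simp: powr_realpow[symmetric] of_nat_diff)
  qed
  moreover have "(\<integral>t. indicator {0<..<1} t * (t ^ (mi_deg j + i - mi_deg k) * ?D t) \<partial>lborel)
    = (if mi_deg j + i - mi_deg k = n - mi_deg k
       then (-1) ^ (n - mi_deg k) * fact (n - mi_deg k) * Beta (?b + 1) (?c + 1) else 0)"
    using par k ji by (intro integral_power_iterated_deriv_Jacobi_weight) (auto simp: of_nat_diff)
  moreover have "(mi_deg j + i - mi_deg k = n - mi_deg k) = (mi_deg j + i = n)"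
    using kj k by auto
  moreover have "?b + 1 = 2 * \<mu> + \<beta> + real CARD('n) + real (n + mi_deg k)" by simp
  moreover have "?c + 1 = \<gamma> + 1 + real (n - mi_deg k)" using k by (simp add: of_nat_diff)
  ultimately show ?thesis
    unfolding UJ_cone_monomial_integral[OF par k] by (simp only:)
qed

theorem theorem4p7:
  fixes \<mu> \<beta> \<gamma> :: real and n :: nat and k j :: "'n::finite \<Rightarrow> nat"
  assumes "\<mu> > - 1/2" and "\<beta> > - real CARD('n)" and "\<gamma> > - 1"
    and "2 * \<mu> + \<beta> + real CARD('n) > 0"
    and "mi_deg k \<le> n" and "mi_deg j \<le> n"
    and "mi_deg k \<ge> mi_deg j \<or>
         (mi_deg j > mi_deg k \<and> (\<exists>i. odd (int (j i) - int (k i))))"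
  shows "bJ TYPE('n) \<beta> \<gamma> \<mu> *
      (LINT p:VV|lborel. UJ \<beta> \<gamma> \<mu> k n p * VJ \<beta> \<gamma> \<mu> j n p * weight \<beta> \<gamma> \<mu> p)
    = mi_fact k * fact (n - mi_deg k) * (-1) ^ n
      * (pochhammer (\<mu> + 1/2) (mi_deg k)
         * pochhammer (2 * \<mu> + \<beta> + real CARD('n)) (n + mi_deg k)
         * pochhammer (\<gamma> + 1) (n - mi_deg k))
      / (pochhammer (\<mu> + (real CARD('n) + 1) / 2) (mi_deg k)
         * pochhammer (2 * \<mu> + \<beta> + \<gamma> + real CARD('n) + 1) (2 * n))
      * (if k = j then 1 else 0)"
proof -
  note par = assms(1,3,4)
  let ?S = "{(j :: 'n \<Rightarrow> nat, i). int (mi_deg j + i) \<le> int n - 1}"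
  let ?U = "\<lambda>j i p. indicator VV p * (UJ \<beta> \<gamma> \<mu> k n p * cone_monomial j i p * weight \<beta> \<gamma> \<mu> p)"
  obtain c where c: "VJ \<beta> \<gamma> \<mu> j n = (\<lambda>p. cone_monomial j (n - mi_deg j) p
    + (\<Sum>(j, i) \<in> ?S. c j i * cone_monomial j i p))"
    using VJ_expansion[OF par assms(6)] by blast
  have int: "integrable lborel (?U j i)" for j i
    by (rule UJ_cone_monomial_integrable[OF par assms(5)])
  have "(LINT p:VV|lborel. UJ \<beta> \<gamma> \<mu> k n p * VJ \<beta> \<gamma> \<mu> j n p * weight \<beta> \<gamma> \<mu> p)
     = (\<integral>p. ?U j (n - mi_deg j) p + (\<Sum>x \<in> ?S. c (fst x) (snd x) * ?U (fst x) (snd x) p) \<partial>lborel)"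
    unfolding set_lebesgue_integral_def real_scaleR_def
  proof (intro Bochner_Integration.integral_cong refl)
    fix p
    have "UJ \<beta> \<gamma> \<mu> k n p * VJ \<beta> \<gamma> \<mu> j n p * weight \<beta> \<gamma> \<mu> p
      = UJ \<beta> \<gamma> \<mu> k n p * cone_monomial j (n - mi_deg j) p * weight \<beta> \<gamma> \<mu> p
        + (\<Sum>x\<in>?S. c (fst x) (snd x) * cone_monomial (fst x) (snd x) p) * (UJ \<beta> \<gamma> \<mu> k n p * weight \<beta> \<gamma> \<mu> p)"
      unfolding c case_prod_unfold by (simp only: distrib_left distrib_right mult_ac)
    then show "indicator VV p * (UJ \<beta> \<gamma> \<mu> k n p * VJ \<beta> \<gamma> \<mu> j n p * weight \<beta> \<gamma> \<mu> p)
      = ?U j (n - mi_deg j) p + (\<Sum>x \<in> ?S. c (fst x) (snd x) * ?U (fst x) (snd x) p)"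
      by (simp only: distrib_left sum_distrib_left sum_distrib_right mult_ac)
  qed
  also have "\<dots> = (\<integral>p. ?U j (n - mi_deg j) p \<partial>lborel)
      + (\<Sum>x \<in> ?S. c (fst x) (snd x) * (\<integral>p. ?U (fst x) (snd x) p \<partial>lborel))"
  proof -
    have sum: "integrable lborel (\<lambda>p. c (fst x) (snd x) * ?U (fst x) (snd x) p)" for x
      by (intro integrable_mult_right int)
    show ?thesis
      unfolding Bochner_Integration.integral_add[OF int Bochner_Integration.integrable_sum[OF sum]]
        Bochner_Integration.integral_sum[OF sum] integral_mult_right_zero ..
  qed
  also have "(\<Sum>x \<in> ?S. c (fst x) (snd x) * (\<integral>p. ?U (fst x) (snd x) p \<partial>lborel)) = 0"
  proof (rule sum.neutral, rule ballI)
    fix x assume "x \<in> ?S"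
    then have "mi_deg (fst x) + snd x < n" by auto
    then show "c (fst x) (snd x) * (\<integral>p. ?U (fst x) (snd x) p \<partial>lborel) = 0"
      using UJ_cone_monomial_integral_nat[OF par assms(5), of "fst x" "snd x"] by simp
  qed
  also have "(\<integral>p. ?U j (n - mi_deg j) p \<partial>lborel)
      = (-1) ^ mi_deg k * (\<Prod>l\<in>UNIV. fact (k l) * real (j l choose k l))
         * ball_integral (\<mu> - 1/2 + real (mi_deg k)) (\<lambda>y. mi_power y (\<lambda>l. j l - k l))
         * ((-1) ^ (n - mi_deg k) * fact (n - mi_deg k)
              * Beta (2 * \<mu> + \<beta> + real CARD('n) + real (n + mi_deg k)) (\<gamma> + 1 + real (n - mi_deg k)))"
    using UJ_cone_monomial_integral_nat[OF par assms(5), of j "n - mi_deg j"] assms(6) by simp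
  finally have main: "(LINT p:VV|lborel. UJ \<beta> \<gamma> \<mu> k n p * VJ \<beta> \<gamma> \<mu> j n p * weight \<beta> \<gamma> \<mu> p)
      = (-1) ^ mi_deg k * (\<Prod>l\<in>UNIV. fact (k l) * real (j l choose k l))
         * ball_integral (\<mu> - 1/2 + real (mi_deg k)) (\<lambda>y. mi_power y (\<lambda>l. j l - k l))
         * ((-1) ^ (n - mi_deg k) * fact (n - mi_deg k)
              * Beta (2 * \<mu> + \<beta> + real CARD('n) + real (n + mi_deg k)) (\<gamma> + 1 + real (n - mi_deg k)))"
    by (simp only: add_0_right)
  show ?thesis
  proof (cases "k = j")
    case False
    have "(\<Prod>l\<in>UNIV. fact (k l) * real (j l choose k l))
       * ball_integral (\<mu> - 1/2 + real (mi_deg k)) (\<lambda>y. mi_power y (\<lambda>l. j l - k l)) = 0"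
    proof (cases "k \<le> j")
      case True
      \<comment> \<open>From \<open>k \<le> j\<close> and \<open>k \<noteq> j\<close> follows
        \<open>mi_deg k < mi_deg j\<close>, which excludes the first alternative of the hypothesis;
        the second supplies an odd component. Because \<open>k \<le> j\<close>, the integer
        difference there is the truncated one in the exponent.\<close>
      with False have "\<not> mi_deg k \<ge> mi_deg j" using mi_deg_eq_imp_eq by blast
      then obtain l where "odd (int (j l) - int (k l))" using assms(7) by blast
      moreover have "int (j l) - int (k l) = int (j l - k l)"
        using le_funD[OF True, of l] by (simp only: of_nat_diff)
      ultimately have "odd (j l - k l)" by (simp only: even_of_nat simp_thms)
      then have "ball_integral (\<mu> - 1/2 + real (mi_deg k)) (\<lambda>y. mi_power y (\<lambda>l. j l - k l)) = 0"
        using par by (intro ball_integral_odd_moment[where i = l]) auto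
      then show ?thesis by (simp only: mult_zero_right)
    next
      case False
      show ?thesis unfolding UJ_cone_monomial_choose_eq_0[OF False] by (rule mult_zero_left)
    qed
    then have "(LINT p:VV|lborel. UJ \<beta> \<gamma> \<mu> k n p * VJ \<beta> \<gamma> \<mu> j n p * weight \<beta> \<gamma> \<mu> p) = 0"
      unfolding main mult.assoc[of "(-1) ^ mi_deg k"] by (simp only: mult_zero_left mult_zero_right)
    with False show ?thesis by (simp only: if_False mult_zero_right)
  next
    case True
    define p where "p = 2 * \<mu> + \<beta> + real CARD('n)"
    define I0 where "I0 = ball_integral (\<mu> - 1/2) (\<lambda>_ :: real ^ 'n. 1)"
    define I1 where "I1 = ball_integral (\<mu> - 1/2 + real (mi_deg k)) (\<lambda>_ :: real ^ 'n. 1)"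
    define A0 where "A0 = Beta p (\<gamma> + 1)"
    define A1 where "A1 = Beta (p + real (n + mi_deg k)) (\<gamma> + 1 + real (n - mi_deg k))"
    \<comment> \<open>The total mass of the weight is the squared norm of the constant 1, so
      definiteness on polynomials shows at once that both factors are nonzero.\<close>
    have "I0 * A0 = cone_inner \<beta> \<gamma> \<mu> (\<lambda>_ :: (real ^ 'n) \<times> real. 1) (\<lambda>_. 1)"
      unfolding cone_inner_def mult_1 weight_integral[OF par] I0_def A0_def p_def ..
    also have "\<dots> \<noteq> 0"
    proof
      assume "cone_inner \<beta> \<gamma> \<mu> (\<lambda>_ :: (real ^ 'n) \<times> real. 1) (\<lambda>_. 1) = 0"
      from cone_inner_polynomial_definite[OF par real_polynomial_function.intros(2) this] show False by simp
    qed
    finally have nz: "I0 \<noteq> 0" "A0 \<noteq> 0" by simp_all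
    have b: "bJ TYPE('n) \<beta> \<gamma> \<mu> = inverse (I0 * A0)"
      unfolding bJ_def weight_integral[OF par] I0_def A0_def p_def ..
    \<comment> \<open>One sign per derivative: \<open>mi_deg k\<close> of them in the ball and
      \<open>n - mi_deg k\<close> in \<open>t\<close>.\<close>
    have s1: "(-1 :: real) ^ mi_deg k * (-1) ^ (n - mi_deg k) = (-1) ^ n"
      using assms(5) by (simp flip: power_add)
    have s2: "(\<Prod>l\<in>UNIV. fact (k l) * real (j l choose k l)) = mi_fact k"
      using True by (simp add: mi_fact_def)
    have s3: "(\<lambda>y :: real ^ 'n. mi_power y (\<lambda>l. j l - k l)) = (\<lambda>_. 1)"
      using True by (simp add: mi_power_def)
    have lhs: "(LINT p:VV|lborel. UJ \<beta> \<gamma> \<mu> k n p * VJ \<beta> \<gamma> \<mu> j n p * weight \<beta> \<gamma> \<mu> p)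
      = mi_fact k * fact (n - mi_deg k) * (-1) ^ n * (I1 * A1)"
      unfolding main s2 s3 s1[symmetric] I1_def A1_def p_def by (simp only: mult_ac)
    have "pochhammer (\<mu> - 1/2 + 1 + real CARD('n) / 2) (mi_deg k) * I1 = pochhammer (\<mu> - 1/2 + 1) (mi_deg k) * I0"
      unfolding I0_def I1_def using par by (intro ball_integral_one_pochhammer) auto
    moreover have "\<mu> - 1/2 + 1 + real CARD('n) / 2 = \<mu> + (real CARD('n) + 1) / 2" by (simp add: field_simps)
    moreover have "\<mu> - 1/2 + 1 = \<mu> + 1/2" by simp
    ultimately have e1: "pochhammer (\<mu> + (real CARD('n) + 1) / 2) (mi_deg k) * I1 = pochhammer (\<mu> + 1/2) (mi_deg k) * I0"
      by (simp only:)
    \<comment> \<open>The first Beta argument is shifted by \<open>n + mi_deg k\<close> and the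
      second by \<open>n - mi_deg k\<close>, so their sum is shifted by \<open>2 * n\<close>: this
      is the last Pochhammer symbol in the denominator of the claim.\<close>
    have "A1 * pochhammer (p + (\<gamma> + 1)) (n + mi_deg k + (n - mi_deg k)) = A0 * pochhammer p (n + mi_deg k) * pochhammer (\<gamma> + 1) (n - mi_deg k)"
      unfolding A0_def A1_def using par by (intro Beta_pochhammer) (auto simp: p_def)
    moreover have "n + mi_deg k + (n - mi_deg k) = 2 * n" using assms(5) by simp
    moreover have "p + (\<gamma> + 1) = 2 * \<mu> + \<beta> + \<gamma> + real CARD('n) + 1" by (simp add: p_def)
    ultimately have e2: "A1 * pochhammer (2 * \<mu> + \<beta> + \<gamma> + real CARD('n) + 1) (2 * n)
        = A0 * pochhammer p (n + mi_deg k) * pochhammer (\<gamma> + 1) (n - mi_deg k)"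
      by simp
    have base1: "0 < \<mu> + (real CARD('n) + 1) / 2"
      using par(1) of_nat_0_le_iff[of "CARD('n)", where 'a = real] unfolding add_divide_distrib by linarith
    have base2: "0 < 2 * \<mu> + \<beta> + \<gamma> + real CARD('n) + 1"
      using par by linarith
    note pos = base1[THEN pochhammer_pos] base2[THEN pochhammer_pos]
    have ratio: "inverse (I0 * A0) * (I1 * A1)
       = pochhammer (\<mu> + 1/2) (mi_deg k) * pochhammer p (n + mi_deg k) * pochhammer (\<gamma> + 1) (n - mi_deg k)
         / (pochhammer (\<mu> + (real CARD('n) + 1) / 2) (mi_deg k) * pochhammer (2 * \<mu> + \<beta> + \<gamma> + real CARD('n) + 1) (2 * n))"
    proof -
      have I1: "I1 = pochhammer (\<mu> + 1/2) (mi_deg k) * I0 / pochhammer (\<mu> + (real CARD('n) + 1) / 2) (mi_deg k)"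
        using e1 pos(1)[of "mi_deg k"] by (intro eq_divide_imp) (auto simp only: mult.commute)
      have A1: "A1 = A0 * pochhammer p (n + mi_deg k) * pochhammer (\<gamma> + 1) (n - mi_deg k) / pochhammer (2 * \<mu> + \<beta> + \<gamma> + real CARD('n) + 1) (2 * n)"
        using e2 pos(2)[of "2 * n"] by (intro eq_divide_imp) (auto simp only:)
      have "inverse (I0 * A0) * (x * I0 / y * (A0 * u * v / w)) = x * u * v / (y * w)" for x y u v w
        using nz by (simp add: field_simps)
      then show ?thesis unfolding I1 A1 .
    qed
    have "bJ TYPE('n) \<beta> \<gamma> \<mu> * (mi_fact k * fact (n - mi_deg k) * (-1) ^ n * (I1 * A1))
      = mi_fact k * fact (n - mi_deg k) * (-1) ^ n * (pochhammer (\<mu> + 1/2) (mi_deg k) * pochhammer p (n + mi_deg k) * pochhammer (\<gamma> + 1) (n - mi_deg k)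
         / (pochhammer (\<mu> + (real CARD('n) + 1) / 2) (mi_deg k) * pochhammer (2 * \<mu> + \<beta> + \<gamma> + real CARD('n) + 1) (2 * n)))"
      unfolding b ratio[symmetric] by (rule mult.left_commute)
    then show ?thesis
      using True unfolding lhs p_def by simp
  qed
qed

end
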